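(* Let $p$ be an odd prime and let $q>7$ be a power of $p$ such that $q \equiv 1, 5$ or $7 \pmod 8$. Then \[ M(q) \geq \lfloor Q \rfloor, \qquad \text{where } Q=\frac{p}{p-1}\left(\frac{\frac{1}{2}\log q -2\log\log q}{\log 2} +1\right). \] In particular, if $p$ is fixed and $q \to \infty$ (through powers of $p$ with $q \equiv 1,5,7 \pmod 8$), then \[ M(q) \geq \left(\frac{p}{p-1}-o(1)\right)\log_4 q . \]
   Context: Let $\mathbb{F}_q$ be the finite field with $q$ elements and $\mathbb{F}_q^*=\mathbb{F}_q\setminus\{0\}$. A Diophantine $m$-tuple over $\mathbb{F}_q$ is a set $\{a_1,\ldots,a_m\}$ of $m$ distinct elements of $\mathbb{F}_q^*$ such that $a_ia_j+1$ is a square in $\mathbb{F}_q$ (where $0$ counts as a square) whenever $i\neq j$. $M(q)$ denotes the maximum size of a Diophantine tuple over $\mathbb{F}_q$. $\log$ is the natural logarithm and $\log_4$ is the logarithm to base $4$. *)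

theory Defs
  imports
    "HOL-Algebra.Ring"
    "HOL-Algebra.Coset"
    "HOL-Computational_Algebra.Primes"
    "HOL-Library.Landau_Symbols"
    Complex_Main
begin

text \<open>Zero counts as a square, and nothing is required of \<open>a \<otimes> a \<oplus> \<one>\<close>.\<close>

definition is_square_in :: "('a, 'b) ring_scheme \<Rightarrow> 'a \<Rightarrow> bool" where
  "is_square_in F x \<longleftrightarrow> (\<exists>y\<in>carrier F. x = y [^]\<^bsub>F\<^esub> (2::nat))"

definition diophantine_tuple :: "('a, 'b) ring_scheme \<Rightarrow> 'a set \<Rightarrow> bool" where
  "diophantine_tuple F S \<longleftrightarrow>
     finite S \<and> S \<subseteq> carrier F - {\<zero>\<^bsub>F\<^esub>} \<and>
     (\<forall>a\<in>S. \<forall>b\<in>S. a \<noteq> b \<longrightarrow> is_square_in F (a \<otimes>\<^bsub>F\<^esub> b \<oplus>\<^bsub>F\<^esub> \<one>\<^bsub>F\<^esub>))"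

text \<open>
  The number written \<open>M(q)\<close> in the literature: it is attached here to a given field \<open>F\<close> of
  order \<open>q\<close>, and depends only on \<open>q\<close> because finite fields of equal order are isomorphic.
  For finite \<open>carrier F\<close> the maximum is over a finite set, nonempty because of \<open>S = {}\<close>.
\<close>

definition max_diophantine :: "('a, 'b) ring_scheme \<Rightarrow> nat" where
  "max_diophantine F = Max {card S | S. diophantine_tuple F S}"

text \<open>
  \<open>F\<close> is a model of the finite field with \<open>q\<close> elements. An infinite carrier type such as
  \<open>nat\<close> contains models for all prime powers \<open>q\<close> at once, which is what gives content to
  statements as \<open>q\<close> tends to infinity.
\<close>

definition is_GF :: "nat \<Rightarrow> ('a, 'b) ring_scheme \<Rightarrow> bool" where
  "is_GF q F \<longleftrightarrow> field F \<and> finite (carrier F) \<and> order F = q"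

end

theory Submission
  imports
    Defs
    "HOL-Computational_Algebra.Polynomial"
    "HOL-Algebra.Multiplicative_Group"
    "HOL-Number_Theory.Gauss"
    "HOL-Analysis.Harmonic_Numbers"
    "HOL-Real_Asymp.Real_Asymp"
begin

text \<open>
  Choose \<open>\<kappa> = \<gamma>\<^sup>2 = \<plusminus>1\<close> such that \<open>1 + \<kappa>\<close> is a square: \<open>\<kappa> = -1\<close> if \<open>q\<close> is \<open>1\<close> modulo \<open>4\<close>, and
  \<open>\<kappa> = 1\<close> if \<open>q\<close> is \<open>7\<close> modulo \<open>8\<close>. The \<open>M\<close> elements \<open>\<gamma> x\<^sup>i\<close> with \<open>i = 1 - M, 3 - M, \<dots>, M - 1\<close> form a
  Diophantine tuple once \<open>1 + \<kappa> x\<^sup>2\<^sup>k\<close> is a square for \<open>1 \<le> k \<le> M - 2\<close>. For \<open>k = p j\<close> this element is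
  the \<open>p\<close>-th power of \<open>1 + \<kappa> x\<^sup>2\<^sup>j\<close>, so only the \<open>k\<close> prime to \<open>p\<close> impose conditions; this saves the
  factor \<open>p / (p - 1)\<close>. A suitable \<open>x\<close> is found by expanding \<open>\<Prod>k. 1 + \<chi> (1 + \<kappa> x\<^sup>2\<^sup>k)\<close> and summing
  over \<open>x\<close>.

  It suffices to bound the sum of \<open>\<chi> (f x)\<close> from below by \<open>- (2 d + 4) \<surd>q\<close> for \<open>f\<close> of degree \<open>d\<close> with
  \<open>f 0 = 1\<close>, which Stepanov's method gives directly: the loss of a factor \<open>2\<close> against Weil's bound
  is absorbed by the term \<open>2 log log q\<close>. No assumption that \<open>f\<close> is not a square is needed: if the
  auxiliary polynomial vanishes identically, then \<open>f r\<^sup>2 = s\<^sup>2\<close> for some \<open>r \<noteq> 0\<close> of small degree, and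
  \<open>r\<close> vanishes wherever \<open>f\<close> takes a non-square value.

  As the field is given by a carrier set and not by a type, polynomials over it are represented by
  polynomials over a type-class ring (\<open>\<int>[X]\<close> in the end), read modulo a prime ideal \<open>I\<close> whose
  residue field is the given field; \<open>T\<close> is a set of representatives.
\<close>

hide_const (open) up_ring.monom up_ring.coeff module.smult Polynomial.order
hide_fact (open) Polynomial.order_def

section \<open>Hasse derivatives\<close>

text \<open>This is P(X + Y), with X the inner and Y the outer variable, so that the coefficients of
  the powers of Y are polynomials in X.\<close>

definition taylor :: "'r::comm_ring_1 poly \<Rightarrow> 'r poly poly" where
  "taylor P = poly (map_poly (\<lambda>c. [:[:c:]:]) P) [:[:0, 1:], 1:]"

text \<open>The divided derivative, formally the l-th derivative over l!. Unlike iterated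
  derivatives it still detects multiplicities of order p and above in characteristic p.\<close>

definition hasse :: "nat \<Rightarrow> 'r::comm_ring_1 poly \<Rightarrow> 'r poly" where
  "hasse l P = coeff (taylor P) l"

lemma taylor_0 [simp]: "taylor 0 = 0"
  by (simp add: taylor_def)

lemma taylor_pCons: "taylor (pCons a P) = [:[:a:]:] + [:[:0, 1:], 1:] * taylor P"
  by (simp add: taylor_def map_poly_pCons)

lemma taylor_add: "taylor (P + Q) = taylor P + taylor Q"
proof (induction P Q rule: poly_induct2)
  case (pCons a P b Q)
  have "[:[:a + b:]:] = [:[:a:]:] + [:[:b:]:]"
    by simp
  then show ?case
    using pCons by (simp only: add_pCons[of a P b Q] taylor_pCons distrib_right ac_simps)
qed simp

lemma taylor_smult: "taylor (smult c P) = smult [:c:] (taylor P)"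
  by (induction P) (simp_all add: taylor_pCons algebra_simps smult_add_right)

text \<open>Substituting X + Y is a ring homomorphism. Comparing coefficients of powers of Y then
  yields the Leibniz rule \<open>hasse_mult\<close> without factorials.\<close>

lemma taylor_mult: "taylor (P * Q) = taylor P * taylor Q"
proof (induction P)
  case (pCons a P)
  have "taylor (pCons 0 (P * Q)) = [:[:0, 1:], 1:] * taylor (P * Q)"
    by (simp add: taylor_pCons)
  then show ?case
    using pCons by (simp add: taylor_pCons taylor_add taylor_smult algebra_simps)
qed simp

lemma hasse_0_right [simp]: "hasse l 0 = 0"
  by (simp add: hasse_def)

lemma hasse_add: "hasse l (P + Q) = hasse l P + hasse l Q"
  by (simp add: hasse_def taylor_add)

lemma hasse_sum: "hasse l (\<Sum>i\<in>A. P i) = (\<Sum>i\<in>A. hasse l (P i))"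
  by (induction A rule: infinite_finite_induct) (simp_all add: hasse_add)

lemma hasse_mult: "hasse l (P * Q) = (\<Sum>i\<le>l. hasse i P * hasse (l - i) Q)"
  by (simp add: hasse_def taylor_mult coeff_mult)

lemma hasse_pCons_0: "hasse 0 (pCons a P) = pCons a (hasse 0 P)"
  by (simp add: hasse_def taylor_pCons)

lemma hasse_pCons_Suc:
  "hasse (Suc l) (pCons a P) = pCons 0 (hasse (Suc l) P) + hasse l P"
  by (simp add: hasse_def taylor_pCons)

lemma hasse_0_left [simp]: "hasse 0 P = P"
  by (induction P) (simp_all add: hasse_pCons_0)

lemma hasse_const_Suc [simp]: "hasse (Suc l) [:a:] = 0"
  by (simp add: hasse_pCons_Suc)

lemma hasse_eq_0: "degree P < l \<Longrightarrow> hasse l P = 0"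
proof (induction P arbitrary: l)
  case (pCons a P)
  then obtain m where m: "l = Suc m" by (cases l) auto
  show ?case
  proof (cases "P = 0")
    case False
    then show ?thesis using pCons m by (simp add: hasse_pCons_Suc)
  qed (simp add: m)
qed simp

lemma degree_hasse_le: "degree (hasse l P) \<le> degree P - l"
proof (induction P arbitrary: l)
  case (pCons a P)
  show ?case
  proof (cases l)
    case (Suc m)
    show ?thesis
    proof (cases "degree P > m")
      case True
      have "degree (pCons 0 (hasse (Suc m) P)) \<le> degree P - m"
        using pCons.IH[of "Suc m"] True
        by (cases "hasse (Suc m) P = 0") (auto simp: degree_pCons_eq_if)
      then show ?thesis
        using pCons.IH[of m] Suc True by (auto simp: hasse_pCons_Suc intro!: degree_add_le)
    next
      case False
      then show ?thesis
        using pCons.IH[of m] Suc by (simp add: hasse_pCons_Suc hasse_eq_0)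
    qed
  qed simp
qed simp

lemma hasse_monom: "hasse l (monom 1 n) = monom (of_nat (n choose l)) (n - l)"
proof (induction n arbitrary: l)
  case 0
  show ?case
  proof (cases l)
    case (Suc m)
    then show ?thesis by (simp add: monom_0)
  qed simp
next
  case (Suc n)
  show ?case
  proof (cases l)
    case (Suc m)
    show ?thesis
    proof (cases "m < n")
      case True
      then have "n - m = Suc (n - Suc m)" by simp
      then show ?thesis
        using Suc.IH \<open>l = Suc m\<close> by (simp add: monom_Suc hasse_pCons_Suc add_monom add.commute flip: add_monom)
    next
      case False
      then show ?thesis
        using Suc.IH \<open>l = Suc m\<close> by (simp add: monom_Suc hasse_pCons_Suc add_monom binomial_eq_0)
    qed
  qed simp
qed

lemma hasse_smult: "hasse l (smult c P) = smult c (hasse l P)"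
  by (simp add: hasse_def taylor_smult)

lemma hasse_diff: "hasse l (P - Q) = hasse l P - hasse l Q"
  using hasse_add[of l "P - Q" Q] by simp

text \<open>Differentiation lowers the degree by \<open>l\<close>, while the factor
  \<open>f ^ l\<close> raises it by at most \<open>d * l\<close>.\<close>

lemma degree_hasse_mult_power_le:
  fixes f :: "'r::comm_ring_1 poly"
  assumes "degree f \<le> d" "d > 0"
  shows "degree (hasse l P * f ^ l) \<le> degree P + (d - 1) * l"
proof (cases "l \<le> degree P")
  case True
  have "degree (hasse l P * f ^ l) \<le> (degree P - l) + d * l"
    using degree_hasse_le[of l P] degree_power_le[of f l] assms(1)
    by (intro degree_mult_le[THEN le_trans] add_mono) (auto intro: le_trans)
  also have "\<dots> = degree P + (d - 1) * l"
    using True assms(2) by (cases d) auto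
  finally show ?thesis .
qed (simp add: hasse_eq_0)

lemma hasse_linear_mult:
  "hasse (Suc l) ([:a, 1:] * P) = [:a, 1:] * hasse (Suc l) P + hasse l P"
  using hasse_pCons_Suc[of l 0 P] by (simp add: hasse_add hasse_smult algebra_simps)

text \<open>Pulling out the power of \<open>f\<close> keeps the degree of the cofactor independent of \<open>h\<close>.\<close>

lemma hasse_power:
  fixes f :: "'r::comm_ring_1 poly"
  assumes "degree f \<le> d" "d > 0"
  shows "\<exists>W. degree W \<le> (d - 1) * i \<and> hasse i (f ^ h) = f ^ (h - i) * W"
proof (induction h arbitrary: i)
  case 0
  show ?case
    by (cases i) (auto intro!: exI[of _ "hasse i 1"] simp: hasse_eq_0)
next
  case (Suc h)
  show ?case
  proof (cases "i \<le> h")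
    case False
    \<comment> \<open>For \<open>i > h\<close> the exponent \<open>Suc h - i\<close> is 0, so the
      derivative itself serves as cofactor.\<close>
    have "degree (hasse i (f ^ Suc h)) \<le> degree f * Suc h - i"
      using degree_hasse_le[of i "f ^ Suc h"] degree_power_le[of f "Suc h"]
      by (meson diff_le_mono le_trans)
    also have "\<dots> \<le> d * i - i"
      using False assms(1) by (intro diff_le_mono mult_le_mono) auto
    also have "\<dots> = (d - 1) * i"
      by (simp add: diff_mult_distrib)
    finally show ?thesis
      using False by (intro exI[of _ "hasse i (f ^ Suc h)"]) auto
  next
    case True
    obtain W where W: "\<And>i. degree (W i) \<le> (d - 1) * i"
        "\<And>i. hasse i (f ^ h) = f ^ (h - i) * W i"
      using Suc by metis
    \<comment> \<open>Leibniz rule for \<open>f * f ^ h\<close>: a term with \<open>m > 0\<close>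
      has \<open>f ^ (m - 1)\<close> to spare beyond \<open>f ^ (Suc h - i)\<close>; for
      \<open>m = 0\<close> the undifferentiated factor \<open>f\<close> supplies the one missing
      power.\<close>
    define V where "V = (\<Sum>m\<le>i. (if m = 0 then W i else hasse m f * f ^ (m - 1) * W (i - m)))"
    have "degree (if m = 0 then W i else hasse m f * f ^ (m - 1) * W (i - m)) \<le> (d - 1) * i"
      if "m \<le> i" for m
    proof (cases "m = 0 \<or> m > d")
      case True
      then show ?thesis using W(1)[of i] assms by (auto simp: hasse_eq_0)
    next
      case False
      have "degree (hasse m f * f ^ (m - 1) * W (i - m)) \<le> (d - m) + d * (m - 1) + (d - 1) * (i - m)"
        using degree_hasse_le[of m f] degree_power_le[of f "m - 1"] W(1)[of "i - m"] assms(1)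
        by (intro degree_mult_le[THEN le_trans] add_mono) (auto intro: le_trans)
      also have "d - m + d * (m - 1) = (d - 1) * m"
        using False by (cases m; cases d) (auto simp: algebra_simps)
      also have "(d - 1) * m + (d - 1) * (i - m) = (d - 1) * i"
        using that by (simp flip: add_mult_distrib2)
      finally show ?thesis using False by simp
    qed
    then have "degree V \<le> (d - 1) * i"
      unfolding V_def by (intro degree_sum_le) auto
    moreover have "hasse i (f ^ Suc h) = f ^ (Suc h - i) * V"
    proof -
      have "hasse i (f ^ Suc h) = (\<Sum>m\<le>i. hasse m f * (f ^ (h - (i - m)) * W (i - m)))"
        by (simp add: hasse_mult W(2))
      also have "\<dots> = (\<Sum>m\<le>i. f ^ (Suc h - i) *
          (if m = 0 then W i else hasse m f * f ^ (m - 1) * W (i - m)))"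
      proof (rule sum.cong)
        fix m assume m: "m \<in> {..i}"
        have "f ^ (Suc h - i) = f * f ^ (h - i)"
          using True by (simp add: Suc_diff_le)
        moreover have "f ^ (h - (i - m)) = f ^ (Suc h - i) * f ^ (m - 1)" if "m \<noteq> 0"
          using that m True by (simp flip: power_add)
        ultimately show "hasse m f * (f ^ (h - (i - m)) * W (i - m)) = f ^ (Suc h - i) *
            (if m = 0 then W i else hasse m f * f ^ (m - 1) * W (i - m))"
          by (cases "m = 0") (auto simp: algebra_simps)
      qed simp
      finally show ?thesis
        by (simp add: V_def sum_distrib_left)
    qed
    ultimately show ?thesis by blast
  qed
qed

section \<open>Polynomials modulo a prime ideal\<close>

locale residue_domain =
  fixes I :: "'r::comm_ring_1 set"
  assumes zero_mem [simp, intro]: "0 \<in> I"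
    and add_mem: "\<And>a b. a \<in> I \<Longrightarrow> b \<in> I \<Longrightarrow> a + b \<in> I"
    and mult_mem: "\<And>a b. a \<in> I \<Longrightarrow> b * a \<in> I"
    and one_nmem [simp]: "1 \<notin> I"
    and prime_mem: "\<And>a b. a * b \<in> I \<Longrightarrow> a \<in> I \<or> b \<in> I"
begin

lemma mult_mem': "a \<in> I \<Longrightarrow> a * b \<in> I"
  using mult_mem[of a b] by (simp add: mult.commute)

lemma mult_mem_iff: "a * b \<in> I \<longleftrightarrow> a \<in> I \<or> b \<in> I"
  using prime_mem mult_mem mult_mem' by blast

lemma uminus_mem_iff: "- a \<in> I \<longleftrightarrow> a \<in> I"
  using mult_mem[of a "-1"] mult_mem[of "-a" "-1"] by auto

lemma diff_mem: "a \<in> I \<Longrightarrow> b \<in> I \<Longrightarrow> a - b \<in> I"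
  using add_mem[of a "-b"] by (simp add: uminus_mem_iff)

lemma sum_mem: "(\<And>x. x \<in> S \<Longrightarrow> g x \<in> I) \<Longrightarrow> sum g S \<in> I"
  by (induction S rule: infinite_finite_induct) (auto intro: add_mem)

lemma power_mem_iff: "a ^ n \<in> I \<longleftrightarrow> a \<in> I \<and> n > 0"
  by (induction n) (auto simp: mult_mem_iff)

lemma prod_mem_iff: "finite S \<Longrightarrow> prod g S \<in> I \<longleftrightarrow> (\<exists>x\<in>S. g x \<in> I)"
  by (induction S rule: finite_induct) (auto simp: mult_mem_iff)

definition eqm (infix "\<sim>" 50) where "a \<sim> b \<longleftrightarrow> a - b \<in> I"

lemma eqm_refl [simp, intro]: "a \<sim> a"
  by (simp add: eqm_def)

lemma eqm_sym: "a \<sim> b \<Longrightarrow> b \<sim> a"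
  using uminus_mem_iff[of "a - b"] by (simp add: eqm_def)

lemma eqm_trans [trans]: "a \<sim> b \<Longrightarrow> b \<sim> c \<Longrightarrow> a \<sim> c"
  using add_mem[of "a - b" "b - c"] by (simp add: eqm_def)

lemma eqm_0_iff: "a \<sim> 0 \<longleftrightarrow> a \<in> I"
  by (simp add: eqm_def)

lemma eqm_mem: "a \<sim> b \<Longrightarrow> a \<in> I \<longleftrightarrow> b \<in> I"
  by (metis eqm_0_iff eqm_sym eqm_trans)

lemma eqm_add: "a \<sim> b \<Longrightarrow> c \<sim> d \<Longrightarrow> a + c \<sim> b + d"
  using add_mem[of "a - b" "c - d"] by (simp add: eqm_def algebra_simps)

lemma eqm_diff: "a \<sim> b \<Longrightarrow> c \<sim> d \<Longrightarrow> a - c \<sim> b - d"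
  using diff_mem[of "a - b" "c - d"] by (simp add: eqm_def algebra_simps)

lemma eqm_mult: "a \<sim> b \<Longrightarrow> c \<sim> d \<Longrightarrow> a * c \<sim> b * d"
proof -
  assume "a \<sim> b" "c \<sim> d"
  then have "(a - b) * c + b * (c - d) \<in> I"
    unfolding eqm_def by (intro add_mem mult_mem mult_mem')
  then show ?thesis by (simp add: eqm_def algebra_simps)
qed

lemma eqm_power: "a \<sim> b \<Longrightarrow> a ^ n \<sim> b ^ n"
  by (induction n) (auto intro: eqm_mult)

lemma eqm_sum: "(\<And>x. x \<in> S \<Longrightarrow> g x \<sim> g' x) \<Longrightarrow> sum g S \<sim> sum g' S"
  by (induction S rule: infinite_finite_induct) (auto intro: eqm_add)

lemma of_nat_mem: "of_nat p \<in> I \<Longrightarrow> p dvd n \<Longrightarrow> of_nat n \<in> I"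
  by (auto elim!: dvdE intro: mult_mem')

end

text \<open>Absorption identity: \<open>p ^ k\<close> divides \<open>i\<close> times the binomial
  coefficient, so if \<open>p\<close> did not divide the latter, \<open>p ^ k\<close> would divide
  the smaller number \<open>i\<close>. The factor \<open>j\<close> serves the derivatives of X^(q
  j).\<close>

lemma prime_dvd_choose_mult:
  fixes p :: nat
  assumes "prime p" "0 < i" "i < p ^ k"
  shows "p dvd (p ^ k * j choose i)"
proof (rule ccontr)
  assume "\<not> p dvd (p ^ k * j choose i)"
  then have "coprime (p ^ k) (p ^ k * j choose i)"
    using assms(1) by (simp add: prime_imp_coprime)
  moreover have "p ^ k dvd i * (p ^ k * j choose i)"
    using assms(2) times_binomial_minus1_eq[of i "p ^ k * j"] by simp
  ultimately have "p ^ k dvd i"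
    by (simp add: coprime_dvd_mult_left_iff)
  then show False
    using assms by (auto dest: dvd_imp_le)
qed

lemma (in residue_domain) freshman:
  assumes "prime p" "of_nat p \<in> I"
  shows "(a + b) ^ (p ^ k) \<sim> a ^ (p ^ k) + b ^ (p ^ k)"
proof -
  define q where "q = p ^ k"
  have "q > 0" using assms(1) by (simp add: q_def prime_gt_0_nat)
  have "(a + b) ^ q = (\<Sum>i\<le>q. of_nat (q choose i) * a ^ i * b ^ (q - i))"
    by (rule binomial_ring)
  also have "\<dots> \<sim> (\<Sum>i\<le>q. if i = 0 then b ^ q else if i = q then a ^ q else 0)"
  proof (rule eqm_sum)
    fix i assume "i \<in> {..q}"
    then have "of_nat (q choose i) \<in> I" if "i \<noteq> 0" "i \<noteq> q"
      using that assms prime_dvd_choose_mult[of p i k 1] of_nat_mem[of p] unfolding q_def by auto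
    then show "of_nat (q choose i) * a ^ i * b ^ (q - i) \<sim>
        (if i = 0 then b ^ q else if i = q then a ^ q else 0)"
      by (auto simp: eqm_0_iff intro: mult_mem')
  qed
  also have "(\<Sum>i\<le>q. if i = 0 then b ^ q else if i = q then a ^ q else 0) =
      (\<Sum>i\<in>{0, q}. if i = 0 then b ^ q else if i = q then a ^ q else 0)"
    by (rule sum.mono_neutral_right) auto
  also have "\<dots> = a ^ q + b ^ q"
    using \<open>q > 0\<close> by (simp add: add.commute)
  finally show ?thesis by (simp add: q_def)
qed

section \<open>Polynomials with coefficients in the ideal, and roots with multiplicity\<close>

definition coeffs_in :: "'r::comm_ring_1 set \<Rightarrow> 'r poly set" where
  "coeffs_in I = {P. \<forall>i. coeff P i \<in> I}"

context residue_domain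
begin

text \<open>Gauss's lemma: the lowest coefficients outside \<open>I\<close> of two factors multiply,
  modulo \<open>I\<close>, to a coefficient of the product. Everything shown for \<open>I\<close>
  thereby applies to polynomials modulo \<open>I\<close>.\<close>

lemma residue_domain_coeffs_in: "residue_domain (coeffs_in I)"
proof
  show "a * b \<in> coeffs_in I \<Longrightarrow> a \<in> coeffs_in I \<or> b \<in> coeffs_in I" for a b
  proof (rule ccontr)
    assume ab: "a * b \<in> coeffs_in I" and "\<not> (a \<in> coeffs_in I \<or> b \<in> coeffs_in I)"
    then have ex: "\<exists>i. coeff a i \<notin> I" "\<exists>i. coeff b i \<notin> I" by (auto simp: coeffs_in_def)
    define i where "i = (LEAST i. coeff a i \<notin> I)"
    define j where "j = (LEAST i. coeff b i \<notin> I)"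
    have i: "coeff a i \<notin> I" "\<And>m. m < i \<Longrightarrow> coeff a m \<in> I"
      unfolding i_def using LeastI_ex[OF ex(1)] not_less_Least by blast+
    have j: "coeff b j \<notin> I" "\<And>m. m < j \<Longrightarrow> coeff b m \<in> I"
      unfolding j_def using LeastI_ex[OF ex(2)] not_less_Least by blast+
    have "coeff (a * b) (i + j) \<sim> (\<Sum>m\<le>i + j. if m = i then coeff a i * coeff b j else 0)"
      unfolding coeff_mult
    proof (rule eqm_sum)
      fix m assume m: "m \<in> {..i + j}"
      consider "m = i" | "m < i" | "m > i" "i + j - m < j" using m by force
      then show "coeff a m * coeff b (i + j - m) \<sim> (if m = i then coeff a i * coeff b j else 0)"
        by cases (use i j in \<open>auto simp: eqm_0_iff intro: mult_mem mult_mem'\<close>)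
    qed
    then have "coeff a i * coeff b j \<in> I"
      using ab eqm_mem by (auto simp: coeffs_in_def)
    then show False using i j prime_mem by blast
  qed
  show "1 \<notin> coeffs_in I"
    using one_nmem by (auto simp: coeffs_in_def dest: spec[of _ 0])
qed (auto simp: coeffs_in_def coeff_mult intro!: add_mem sum_mem mult_mem)

lemma poly_mem: "P \<in> coeffs_in I \<Longrightarrow> poly P a \<in> I"
  unfolding poly_altdef coeffs_in_def by (auto intro!: sum_mem mult_mem')

text \<open>Division by X - a at a point with \<open>e a > 0\<close> lowers both the degree and the
  multiplicity demanded at \<open>a\<close> by one. The remainder lies in \<open>I\<close>, so the
  quotient is still nonzero modulo \<open>I\<close>.\<close>

lemma root_count:
  assumes "P \<notin> coeffs_in I" "finite Z" "\<And>a b. a \<in> Z \<Longrightarrow> b \<in> Z \<Longrightarrow> a \<noteq> b \<Longrightarrow> a - b \<notin> I"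
    and "\<And>a l. a \<in> Z \<Longrightarrow> l < e a \<Longrightarrow> poly (hasse l P) a \<in> I"
  shows "sum e Z \<le> degree P"
  using assms(1,4)
proof (induction "degree P" arbitrary: P e rule: less_induct)
  case less
  show ?case
  proof (cases "\<exists>a\<in>Z. e a > 0")
    case True
    then obtain a where a: "a \<in> Z" "e a > 0" by blast
    define G where "G = synthetic_div P a"
    define c where "c = poly P a"
    have P: "P = [:- a, 1:] * G + [:c:]"
      using synthetic_div_correct'[of a P] by (simp add: G_def c_def)
    have c: "c \<in> I" using less.prems(2)[OF a] by (simp add: c_def)
    have "G \<notin> coeffs_in I"
    proof
      assume "G \<in> coeffs_in I"
      then have "[:- a, 1:] * G + [:c:] \<in> coeffs_in I"
        using c by (auto simp: coeffs_in_def coeff_pCons split: nat.splits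
            intro!: add_mem diff_mem mult_mem)
      then show False using less.prems(1) P by simp
    qed
    then have "G \<noteq> 0" by (auto simp: coeffs_in_def)
    then have "degree P \<noteq> 0" by (simp add: G_def synthetic_div_eq_0_iff)
    then have deg: "degree P = Suc (degree G)" by (simp add: G_def degree_synthetic_div)
    have H: "hasse (Suc l) P = [:- a, 1:] * hasse (Suc l) G + hasse l G" for l
      unfolding P hasse_add hasse_linear_mult by simp
    have "sum (e(a := e a - 1)) Z \<le> degree G"
    proof (rule less.hyps)
      fix b l assume b: "b \<in> Z" and l: "l < (e(a := e a - 1)) b"
      show "poly (hasse l G) b \<in> I"
      proof (cases "b = a")
        case True
        then have "poly (hasse (Suc l) P) a \<in> I" using l a by (intro less.prems(2)) auto
        then show ?thesis using True by (simp add: H)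
      next
        case False
        \<comment> \<open>Away from \<open>a\<close> the factor \<open>b - a\<close> can be
          cancelled modulo \<open>I\<close>, so vanishing passes from the derivatives of
          \<open>P\<close> to those of \<open>G\<close> by induction on the order.\<close>
        then have ba: "b - a \<notin> I" using assms(3) a b by blast
        from False l have "l < e b" by simp
        then show ?thesis
        proof (induction l)
          case 0
          then have "poly P b - c \<in> I" using less.prems(2)[OF b 0] c by (simp add: diff_mem)
          moreover have "poly P b - c = (b - a) * poly G b" by (subst P) (simp add: algebra_simps)
          ultimately show ?case using ba prime_mem by fastforce
        next
          case (Suc l)
          then have "poly (hasse (Suc l) P) b - poly (hasse l G) b \<in> I"
            using less.prems(2)[OF b, of "Suc l"] by (auto intro: diff_mem)
          moreover have "poly (hasse (Suc l) P) b - poly (hasse l G) b =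
              (b - a) * poly (hasse (Suc l) G) b"
            by (simp add: H algebra_simps)
          ultimately show ?case using ba prime_mem by fastforce
        qed
      qed
    qed (use deg \<open>G \<notin> coeffs_in I\<close> in auto)
    moreover have "sum (e(a := e a - 1)) Z = sum e Z - 1"
      using assms(2) a by (simp add: sum.remove[of Z a])
    ultimately show ?thesis using deg by simp
  qed simp
qed

end

section \<open>Stepanov's method\<close>

text \<open>The residue ring is the field with \<open>q\<close> elements, and \<open>T\<close> holds
  one representative of each class. \<open>h\<close> is the exponent of Euler's criterion;
  \<open>q = 2 * h + 1\<close> makes \<open>q\<close> odd.\<close>

locale finite_residue_field = residue_domain I for I :: "'r::comm_ring_1 set" +
  fixes T :: "'r set" and p k q h :: nat
  assumes finite_T: "finite T" and card_T: "card T = q"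
    and rep_ex: "\<And>x. \<exists>t\<in>T. x - t \<in> I"
    and rep_unique: "\<And>s t. s \<in> T \<Longrightarrow> t \<in> T \<Longrightarrow> s - t \<in> I \<Longrightarrow> s = t"
    and prime_p: "prime p" and q_eq: "q = p ^ k" and q_eq_h: "q = 2 * h + 1"
    and p_mem: "of_nat p \<in> I"
    and power_q: "\<And>a. a ^ q - a \<in> I"
begin

lemma card_subset_T_le: "Z \<subseteq> T \<Longrightarrow> card Z \<le> q"
  using card_mono[OF finite_T] by (simp add: card_T)

lemma q_gt_1: "q > 1"
proof -
  obtain s t where st: "s \<in> T" "t \<in> T" "0 - s \<in> I" "1 - t \<in> I" using rep_ex by meson
  then have "s \<noteq> t"
    using diff_mem[of "0 - s" "1 - t"] uminus_mem_iff[of 1] by auto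
  then have "card {s, t} \<le> q" using st by (intro card_subset_T_le) auto
  then show ?thesis using \<open>s \<noteq> t\<close> by simp
qed

lemma h_pos: "h > 0"
  using q_gt_1 q_eq_h by linarith

lemma two_nmem: "2 \<notin> I"
proof
  assume "2 \<in> I"
  have "k \<noteq> 0" using q_eq q_gt_1 by (cases k) auto
  moreover have "odd (p ^ k)" using q_eq_h unfolding q_eq[symmetric] by simp
  ultimately have "odd p" by simp
  then obtain m where "p = 2 * m + 1" by (auto elim: oddE)
  then have "of_nat p - of_nat m * 2 = (1::'r)" by simp
  then show False using diff_mem[OF p_mem mult_mem[OF \<open>2 \<in> I\<close>, of "of_nat m"]] by simp
qed

lemma power_2h: "a \<notin> I \<Longrightarrow> a ^ (2 * h) - 1 \<in> I"
proof -
  assume a: "a \<notin> I"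
  have "a ^ q - a = a * (a ^ (2 * h) - 1)"
    unfolding q_eq_h by (simp add: algebra_simps)
  then have "a * (a ^ (2 * h) - 1) \<in> I" using power_q[of a] by simp
  then show ?thesis using a prime_mem by blast
qed

lemma power_h_cases: "a \<in> I \<or> a ^ h - 1 \<in> I \<or> a ^ h + 1 \<in> I"
proof -
  have "(a ^ h - 1) * (a ^ h + 1) = a ^ (2 * h) - 1"
    by (simp add: power_add algebra_simps mult_2_right)
  then show ?thesis using power_2h[of a] prime_mem[of "a ^ h - 1" "a ^ h + 1"] by auto
qed

text \<open>Pigeonhole principle in place of elimination: there are more assignments than value
  vectors modulo \<open>I\<close>, and the difference of two assignments with equal values is a
  nonzero solution because \<Phi> respects differences.\<close>

lemma homogeneous_system:
  fixes \<Phi> :: "('u \<Rightarrow> 'r) \<Rightarrow> 'v \<Rightarrow> 'r"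
  assumes "finite U" "finite V" "card V < card U"
    and lin: "\<And>x y v. \<Phi> (\<lambda>u. x u - y u) v = \<Phi> x v - \<Phi> y v"
  obtains x u where "\<And>v. v \<in> V \<Longrightarrow> \<Phi> x v \<in> I" "u \<in> U" "x u \<notin> I"
proof -
  define rp where "rp y = (SOME t. t \<in> T \<and> y - t \<in> I)" for y
  have rp: "rp y \<in> T" "y - rp y \<in> I" for y
    unfolding rp_def using someI_ex[of "\<lambda>t. t \<in> T \<and> y - t \<in> I"] rep_ex[of y] by blast+
  define X where "X = U \<rightarrow>\<^sub>E T"
  define Y where "Y = V \<rightarrow>\<^sub>E T"
  define G where "G x = (\<lambda>v\<in>V. rp (\<Phi> x v))" for x
  have "card Y < card X"
    using assms q_gt_1 by (simp add: X_def Y_def card_PiE card_T)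
  moreover have "finite Y" "G ` X \<subseteq> Y"
    using assms finite_T rp by (auto simp: X_def Y_def G_def finite_PiE)
  ultimately have "\<not> inj_on G X"
    using card_inj_on_le linorder_not_less by blast
  then obtain x y where xy: "x \<in> X" "y \<in> X" "x \<noteq> y" "G x = G y"
    by (auto simp: inj_on_def)
  then obtain u where u: "u \<in> U" "x u \<noteq> y u"
    unfolding X_def by (meson PiE_ext)
  show ?thesis
  proof (rule that[of "\<lambda>u. x u - y u" u])
    fix v assume "v \<in> V"
    then have "rp (\<Phi> x v) = rp (\<Phi> y v)" using fun_cong[OF xy(4), of v] by (simp add: G_def)
    then show "\<Phi> (\<lambda>u. x u - y u) v \<in> I"
      using diff_mem[OF rp(2)[of "\<Phi> x v"] rp(2)[of "\<Phi> y v"]] by (simp add: lin)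
  next
    have "x u \<in> T" "y u \<in> T" using u xy by (auto simp: X_def)
    then show "x u - y u \<notin> I" using u(2) rep_unique by blast
  qed (rule u(1))
qed

lemma monom_nmem: "monom 1 n \<notin> coeffs_in I"
  by (auto simp: coeffs_in_def intro!: exI[of _ n])

text \<open>By \<open>prime_dvd_choose_mult\<close> the derivatives of X^(q j) of orders 1 to q - 1
  vanish modulo \<open>I\<close>, so this monomial behaves like a constant.\<close>

lemma hasse_monom_mult:
  assumes "l < q"
  shows "hasse l (monom 1 (q * j) * P) - monom 1 (q * j) * hasse l P \<in> coeffs_in I"
proof -
  interpret PI: residue_domain "coeffs_in I" by (rule residue_domain_coeffs_in)
  have "hasse l (monom 1 (q * j) * P) =
      monom 1 (q * j) * hasse l P + (\<Sum>i<l. hasse (Suc i) (monom 1 (q * j)) * hasse (l - Suc i) P)"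
    by (simp add: hasse_mult sum.atMost_shift)
  moreover have "(\<Sum>i<l. hasse (Suc i) (monom 1 (q * j)) * hasse (l - Suc i) P) \<in> coeffs_in I"
  proof (intro PI.sum_mem PI.mult_mem')
    fix i assume "i \<in> {..<l}"
    then have "of_nat (q * j choose Suc i) \<in> I"
      using assms prime_p q_eq by (intro of_nat_mem[OF p_mem] ) (auto intro!: prime_dvd_choose_mult)
    then show "hasse (Suc i) (monom 1 (q * j)) \<in> coeffs_in I"
      by (simp add: hasse_monom coeffs_in_def)
  qed
  ultimately show ?thesis by simp
qed

text \<open>The blocks before \<open>j0\<close> vanish modulo \<open>I\<close> and those after it
  carry a further factor X^q. This isolates \<open>r j0\<close> modulo X^q.\<close>

lemma lowest_block:
  assumes "\<And>j. j < j0 \<Longrightarrow> r j \<in> coeffs_in I" "j0 < J"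
  obtains C where "(\<Sum>j<J. monom 1 (q * j) * r j) -
      monom 1 (q * j0) * (r j0 + monom 1 q * C) \<in> coeffs_in I"
proof -
  interpret PI: residue_domain "coeffs_in I" by (rule residue_domain_coeffs_in)
  define C where "C = (\<Sum>j\<in>{j0<..<J}. monom 1 (q * (j - j0 - 1)) * r j)"
  have J: "{..<J} = {..<j0} \<union> insert j0 {j0<..<J}" using assms(2) by auto
  have "(\<Sum>j<J. monom 1 (q * j) * r j) = (\<Sum>j<j0. monom 1 (q * j) * r j) +
      (\<Sum>j\<in>insert j0 {j0<..<J}. monom 1 (q * j) * r j)"
    unfolding J by (rule sum.union_disjoint) auto
  also have "(\<Sum>j\<in>insert j0 {j0<..<J}. monom 1 (q * j) * r j) =
      monom 1 (q * j0) * r j0 + (\<Sum>j\<in>{j0<..<J}. monom 1 (q * j) * r j)"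
    by simp
  also have "(\<Sum>j\<in>{j0<..<J}. monom 1 (q * j) * r j) = monom 1 (q * j0) * (monom 1 q * C)"
    unfolding C_def sum_distrib_left
  proof (rule sum.cong)
    fix j assume "j \<in> {j0<..<J}"
    then obtain m where "j = j0 + 1 + m"
      by (auto simp: less_iff_Suc_add)
    then have "q * j = q * j0 + (q + q * (j - j0 - 1))"
      by (simp add: algebra_simps)
    then show "monom 1 (q * j) * r j =
        monom 1 (q * j0) * (monom 1 q * (monom 1 (q * (j - j0 - 1)) * r j))"
      by (simp add: mult_monom flip: mult.assoc)
  qed simp
  finally have "(\<Sum>j<J. monom 1 (q * j) * r j) - monom 1 (q * j0) * (r j0 + monom 1 q * C) =
      (\<Sum>j<j0. monom 1 (q * j) * r j)"
    by (simp add: algebra_simps)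
  moreover have "\<dots> \<in> coeffs_in I"
    using assms(1) by (intro PI.sum_mem PI.mult_mem) auto
  ultimately show ?thesis using that[of C] by (simp only:)
qed

text \<open>Writing f = 1 + X g, Frobenius gives f^q = 1 + X^q g^q modulo \<open>I\<close>; hence
  \<open>f ^ q\<close> counts as 1 modulo X^q.\<close>

lemma power_q_lowest:
  assumes "poly f 0 = 1"
  obtains C where "f ^ q - (1 + monom 1 q * C) \<in> coeffs_in I"
proof -
  interpret PI: residue_domain "coeffs_in I" by (rule residue_domain_coeffs_in)
  obtain g where g: "f = pCons 1 g"
    using assms by (cases f) auto
  have f: "f = 1 + monom 1 1 * g"
    unfolding g by (simp add: monom_Suc one_pCons)
  have "of_nat p \<in> coeffs_in I"
    using p_mem by (auto simp: coeffs_in_def of_nat_poly coeff_pCons split: nat.splits)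
  then have "(1 + monom 1 1 * g) ^ q - (1 ^ q + (monom 1 1 * g) ^ q) \<in> coeffs_in I"
    using PI.freshman[OF prime_p, of 1 "monom 1 1 * g" k] by (simp add: q_eq PI.eqm_def)
  then show ?thesis
    using that[of "g ^ q"] unfolding f[symmetric] by (simp add: power_mult_distrib monom_power)
qed

text \<open>The first blocks r, s that do not both vanish satisfy f r^2 = s^2 modulo
  \<open>I\<close> and X^q and, the degrees being below \<open>q\<close>, modulo \<open>I\<close>
  alone. This forces r to vanish wherever f^h is -1, hence at no more than \<open>D\<close>
  points.\<close>

lemma stepanov_nonvanishing:
  assumes "poly f 0 = 1" "degree f \<le> d" "2 * D + d < q"
    and "\<And>j. degree (r j) \<le> D" "\<And>j. degree (s j) \<le> D"
    and "j < J" "r j \<notin> coeffs_in I \<or> s j \<notin> coeffs_in I"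
    and van: "(\<Sum>j<J. monom 1 (q * j) * (r j + s j * f ^ h)) \<in> coeffs_in I"
  shows "card {a \<in> T. poly f a ^ h + 1 \<in> I} \<le> D"
proof -
  interpret PI: residue_domain "coeffs_in I" by (rule residue_domain_coeffs_in)
  define j0 where "j0 = (LEAST j. r j \<notin> coeffs_in I \<or> s j \<notin> coeffs_in I)"
  have j0: "r j0 \<notin> coeffs_in I \<or> s j0 \<notin> coeffs_in I"
    unfolding j0_def by (rule LeastI[of _ j]) (rule assms)
  have "j0 < J"
    using Least_le[of "\<lambda>j. r j \<notin> coeffs_in I \<or> s j \<notin> coeffs_in I" j] assms(6,7)
    by (simp add: j0_def)
  have low: "r j \<in> coeffs_in I" "s j \<in> coeffs_in I" if "j < j0" for j
    using not_less_Least that unfolding j0_def by blast+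
  define A where "A = (\<Sum>j<J. monom 1 (q * j) * r j)"
  define B where "B = (\<Sum>j<J. monom 1 (q * j) * s j)"
  obtain A' where A': "PI.eqm A (monom 1 (q * j0) * (r j0 + monom 1 q * A'))"
    using lowest_block[of j0 r J] low \<open>j0 < J\<close> unfolding PI.eqm_def A_def by blast
  obtain B' where B': "PI.eqm B (monom 1 (q * j0) * (s j0 + monom 1 q * B'))"
    using lowest_block[of j0 s J] low \<open>j0 < J\<close> unfolding PI.eqm_def B_def by blast
  obtain C where C: "PI.eqm (f ^ q) (1 + monom 1 q * C)"
    using power_q_lowest[OF assms(1)] unfolding PI.eqm_def by blast
  have "A + B * f ^ h \<in> coeffs_in I"
    using van by (simp add: A_def B_def sum.distrib sum_distrib_right distrib_left mult.assoc)
  \<comment> \<open>The conjugate factor removes the half-power: as \<open>q = 2 * h + 1\<close>,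
    only \<open>f ^ q\<close> remains, which \<open>power_q_lowest\<close> controls.\<close>
  then have "f * (A - B * f ^ h) * (A + B * f ^ h) \<in> coeffs_in I"
    by (rule PI.mult_mem)
  also have "f * (A - B * f ^ h) * (A + B * f ^ h) = f * (A * A) - f ^ q * (B * B)"
    by (simp add: q_eq_h power_add mult_2_right algebra_simps)
  finally have "f * (A * A) - f ^ q * (B * B) \<in> coeffs_in I" .
  moreover have "PI.eqm (f * (A * A) - f ^ q * (B * B))
     (f * ((monom 1 (q * j0) * (r j0 + monom 1 q * A')) * (monom 1 (q * j0) * (r j0 + monom 1 q * A')))
      - (1 + monom 1 q * C) *
        ((monom 1 (q * j0) * (s j0 + monom 1 q * B')) * (monom 1 (q * j0) * (s j0 + monom 1 q * B'))))"
    by (intro PI.eqm_diff PI.eqm_mult PI.eqm_refl A' B' C)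
  ultimately have "f * ((monom 1 (q * j0) * (r j0 + monom 1 q * A')) * (monom 1 (q * j0) * (r j0 + monom 1 q * A')))
      - (1 + monom 1 q * C) *
        ((monom 1 (q * j0) * (s j0 + monom 1 q * B')) * (monom 1 (q * j0) * (s j0 + monom 1 q * B'))) \<in> coeffs_in I"
    using PI.eqm_mem by blast
  also have "f * ((monom 1 (q * j0) * (r j0 + monom 1 q * A')) * (monom 1 (q * j0) * (r j0 + monom 1 q * A')))
      - (1 + monom 1 q * C) *
        ((monom 1 (q * j0) * (s j0 + monom 1 q * B')) * (monom 1 (q * j0) * (s j0 + monom 1 q * B'))) =
      monom 1 (q * j0) * (monom 1 (q * j0) * ((f * (r j0 * r j0) - s j0 * s j0)
      + monom 1 q * (f * (2 * r j0 * A' + monom 1 q * A' * A') - (2 * s j0 * B' + monom 1 q * B' * B')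
        - C * ((s j0 + monom 1 q * B') * (s j0 + monom 1 q * B')))))"
    by (simp add: algebra_simps)
  finally obtain D' where D': "(f * (r j0 * r j0) - s j0 * s j0) + monom 1 q * D' \<in> coeffs_in I"
    using monom_nmem by (auto simp: PI.mult_mem_iff)
  have "degree (f * (r j0 * r j0)) \<le> d + (D + D)"
    using assms(2,4) by (intro degree_mult_le[THEN le_trans] add_mono) auto
  moreover have "degree (s j0 * s j0) \<le> D + D"
    using assms(5) by (intro degree_mult_le[THEN le_trans] add_mono) auto
  ultimately have deg: "degree (f * (r j0 * r j0) - s j0 * s j0) < q"
    using assms(3) degree_diff_le[of "f * (r j0 * r j0)" "d + (D + D)" "s j0 * s j0"] by linarith
  have mem: "f * (r j0 * r j0) - s j0 * s j0 \<in> coeffs_in I"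
    unfolding coeffs_in_def
  proof (clarify)
    fix i
    show "coeff (f * (r j0 * r j0) - s j0 * s j0) i \<in> I"
    proof (cases "i < q")
      case True
      then have "coeff (monom 1 q * D') i = 0" by (simp add: coeff_monom_mult)
      moreover have "coeff (f * (r j0 * r j0) - s j0 * s j0 + monom 1 q * D') i \<in> I"
        using D' unfolding coeffs_in_def by blast
      ultimately show ?thesis by simp
    next
      case False
      then show ?thesis using deg by (simp add: coeff_eq_0 del: coeff_diff)
    qed
  qed
  have "r j0 \<notin> coeffs_in I"
  proof
    assume r: "r j0 \<in> coeffs_in I"
    then have "f * (r j0 * r j0) \<in> coeffs_in I"
      by (intro PI.mult_mem)
    from PI.diff_mem[OF this mem] have "s j0 * s j0 \<in> coeffs_in I" by simp
    then have "s j0 \<in> coeffs_in I" by (simp add: PI.mult_mem_iff)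
    with r j0 show False by blast
  qed
  define Z where "Z = {a \<in> T. poly f a ^ h + 1 \<in> I}"
  have "poly (r j0) a \<in> I" if "a \<in> Z" for a
  \<comment> \<open>Taking \<open>h\<close>-th powers of f r^2 = s^2 turns the left side into -1,
    whereas the right side becomes 1 or 0.\<close>
  proof (rule ccontr)
    assume nr: "poly (r j0) a \<notin> I"
    have "poly f a * poly (r j0) a ^ 2 \<sim> poly (s j0) a ^ 2"
      using poly_mem[OF mem, of a] by (simp add: eqm_def power2_eq_square)
    then have "(poly f a * poly (r j0) a ^ 2) ^ h \<sim> (poly (s j0) a ^ 2) ^ h"
      by (rule eqm_power)
    then have 1: "poly f a ^ h * poly (r j0) a ^ (2 * h) \<sim> poly (s j0) a ^ (2 * h)"
      by (simp add: power_mult_distrib power_mult)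
    have 2: "poly f a ^ h * poly (r j0) a ^ (2 * h) \<sim> - 1 * 1"
      using that power_2h[OF nr] by (intro eqm_mult) (simp_all add: Z_def eqm_def)
    have "- 1 \<sim> poly (s j0) a ^ (2 * h)"
      using eqm_trans[OF eqm_sym[OF 2] 1] by simp
    moreover have "poly (s j0) a ^ (2 * h) \<sim> 1 \<or> poly (s j0) a ^ (2 * h) \<sim> 0"
      using power_2h[of "poly (s j0) a"] h_pos by (auto simp: eqm_def power_mem_iff)
    ultimately have "- 1 \<sim> 1 \<or> - 1 \<sim> 0" using eqm_trans by blast
    then have "- 2 \<in> I \<or> - 1 \<in> I" by (simp add: eqm_def)
    then show False using two_nmem uminus_mem_iff one_nmem by blast
  qed
  then have "sum (\<lambda>_. 1) Z \<le> degree (r j0)"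
    using \<open>r j0 \<notin> coeffs_in I\<close> finite_T rep_unique
    by (intro root_count) (auto simp: Z_def)
  then show ?thesis
    using assms(4)[of j0] by (simp add: Z_def)
qed

text \<open>The auxiliary polynomial is the sum of X^(q j) (r_j + s_j f^h) over j < J, with 2 J (D +
  1) free coefficients. At the counted points X^q acts as X and f^h as -1, so vanishing to order
  \<open>L\<close> follows from the fewer linear conditions in \<open>count\<close>. If the
  polynomial is zero modulo \<open>I\<close>, \<open>stepanov_nonvanishing\<close> gives the first
  alternative; otherwise its degree gives the second.\<close>

theorem stepanov:
  assumes f0: "poly f 0 = 1" and deg_f: "degree f \<le> d" and d: "d > 0"
    and DJ: "2 * D + d < q" "J > 0" and l: "L \<le> h"
    and count: "(\<Sum>l<L. D + J + (d - 1) * l) < 2 * (D + 1) * J"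
  shows "card {a \<in> T. poly f a ^ h + 1 \<in> I} \<le> D \<or>
    L * card {a \<in> T. poly f a ^ h + 1 \<in> I} \<le> D + d * h + q * (J - 1)"
proof -
  interpret PI: residue_domain "coeffs_in I" by (rule residue_domain_coeffs_in)
  define Z where "Z = {a \<in> T. poly f a ^ h + 1 \<in> I}"
  obtain W where W: "\<And>i. degree (W i) \<le> (d - 1) * i"
      "\<And>i. hasse i (f ^ h) = f ^ (h - i) * W i"
    using hasse_power[OF deg_f d, of _ h] by metis
  \<comment> \<open>The blocks with index \<open>j < J\<close> are the r_j, those with index
    \<open>J + j\<close> the s_j.\<close>
  define blk where "blk x j = (\<Sum>i\<le>D. monom (x (j, i)) i)" for x :: "nat \<times> nat \<Rightarrow> 'r" and j
  \<comment> \<open>Chosen such that \<open>f ^ l * hasse l (f ^ h * s) = f ^ h * V l s\<close> for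
    \<open>l \<le> h\<close>: the factor \<open>f ^ l\<close> restores the powers lost by
    differentiation.\<close>
  define V where "V l s = (\<Sum>i\<le>l. hasse (l - i) s * f ^ (l - i) * W i)" for l s
  \<comment> \<open>Represents the values of \<open>f ^ l * hasse l R\<close> at the counted points,
    with \<open>a\<close> put for \<open>a ^ q\<close> and -1 for \<open>poly f a ^ h\<close>. Its
    degree is low, and its coefficients are the linear conditions.\<close>
  define E where "E x l = (\<Sum>j<J. monom 1 j * (hasse l (blk x j) * f ^ l - V l (blk x (J + j))))" for x l
  have deg_blk: "degree (blk x j) \<le> D" for x j
    unfolding blk_def by (intro degree_sum_le) (auto intro: degree_monom_le[THEN le_trans])
  have deg_E: "degree (E x l) < D + J + (d - 1) * l" for x l
  proof -
    have H: "degree (hasse l s * f ^ l) \<le> D + (d - 1) * l" if "degree s \<le> D" for s l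
      using degree_hasse_mult_power_le[OF deg_f d, of l s] that by linarith
    have "degree (V l s) \<le> D + (d - 1) * l" if "degree s \<le> D" for s
      unfolding V_def
    proof (intro degree_sum_le)
      fix i assume "i \<in> {..l}"
      then have "(d - 1) * (l - i) + (d - 1) * i = (d - 1) * l"
        by (simp flip: add_mult_distrib2)
      moreover have "degree (hasse (l - i) s * f ^ (l - i) * W i) \<le> D + (d - 1) * (l - i) + (d - 1) * i"
        using H[OF that, of "l - i"] W(1)[of i] degree_mult_le[of "hasse (l - i) s * f ^ (l - i)" "W i"]
        by linarith
      ultimately show "degree (hasse (l - i) s * f ^ (l - i) * W i) \<le> D + (d - 1) * l"
        by simp
    qed simp
    then have diff: "degree (hasse l (blk x j) * f ^ l - V l (blk x (J + j))) \<le> D + (d - 1) * l" for j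
      using H deg_blk by (intro degree_diff_le) auto
    have "degree (E x l) \<le> (J - 1) + (D + (d - 1) * l)"
      unfolding E_def
    proof (intro degree_sum_le)
      fix j assume "j \<in> {..<J}"
      then have "degree (monom (1::'r) j) \<le> J - 1"
        using degree_monom_le[of "1::'r" j] by simp
      then show "degree (monom 1 j * (hasse l (blk x j) * f ^ l - V l (blk x (J + j)))) \<le>
          (J - 1) + (D + (d - 1) * l)"
        using diff by (intro degree_mult_le[THEN le_trans] add_mono)
    qed simp
    then show ?thesis using DJ by linarith
  qed
  define \<Phi> where "\<Phi> x v = coeff (E x (fst v)) (snd v)" for x v
  have blk_diff: "blk (\<lambda>u. x u - y u) j = blk x j - blk y j" for x y j
    by (simp add: blk_def sum_subtractf flip: diff_monom)
  have V_diff: "V l (s - t) = V l s - V l t" for l s t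
    by (simp add: V_def hasse_diff algebra_simps sum_subtractf)
  have "E (\<lambda>u. x u - y u) l = E x l - E y l" for x y l
    unfolding E_def blk_diff V_diff hasse_diff sum_subtractf[symmetric]
    by (rule sum.cong) (simp_all add: algebra_simps)
  then have lin: "\<Phi> (\<lambda>u. x u - y u) v = \<Phi> x v - \<Phi> y v" for x y v
    by (simp add: \<Phi>_def)
  obtain x u where x: "\<And>v. v \<in> Sigma {..<L} (\<lambda>l. {..<D + J + (d - 1) * l}) \<Longrightarrow> \<Phi> x v \<in> I"
    and u: "u \<in> {..<2 * J} \<times> {..D}" "x u \<notin> I"
    by (rule homogeneous_system[of "{..<2 * J} \<times> {..D}" "Sigma {..<L} (\<lambda>l. {..<D + J + (d - 1) * l})" \<Phi>])
      (use count lin in \<open>auto simp: algebra_simps\<close>)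
  have E_mem: "E x l \<in> coeffs_in I" if "l < L" for l
    unfolding coeffs_in_def
  proof clarify
    fix n
    show "coeff (E x l) n \<in> I"
    proof (cases "n < D + J + (d - 1) * l")
      case True
      then show ?thesis using x[of "(l, n)"] that by (simp add: \<Phi>_def)
    next
      case False
      then show ?thesis using deg_E[of x l] by (simp add: coeff_eq_0)
    qed
  qed
  define R where "R = (\<Sum>j<J. monom 1 (q * j) * (blk x j + blk x (J + j) * f ^ h))"
  have van: "poly (hasse l R) a \<in> I" if "a \<in> Z" "l < L" for a l
  proof -
    have fa: "poly f a ^ h \<sim> - 1" using that by (simp add: Z_def eqm_def)
    \<comment> \<open>This permits cancelling \<open>poly f a ^ l\<close> at the end.\<close>
    have "poly f a \<notin> I"
    proof
      assume "poly f a \<in> I"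
      then have "poly f a ^ h + 1 - poly f a ^ h \<in> I"
        using that h_pos by (intro diff_mem) (auto simp: Z_def power_mem_iff)
      then show False by simp
    qed
    have "PI.eqm (hasse l R) (\<Sum>j<J. monom 1 (q * j) * hasse l (blk x j + blk x (J + j) * f ^ h))"
      unfolding R_def hasse_sum
      by (intro PI.eqm_sum) (use hasse_monom_mult l that q_eq_h in \<open>auto simp: PI.eqm_def\<close>)
    then have "poly (hasse l R) a \<sim> (\<Sum>j<J. a ^ (q * j) * poly (hasse l (blk x j + blk x (J + j) * f ^ h)) a)"
      using poly_mem[of _ a] by (fastforce simp: PI.eqm_def eqm_def poly_sum poly_monom)
    then have "poly f a ^ l * poly (hasse l R) a \<sim>
        poly f a ^ l * (\<Sum>j<J. a ^ (q * j) * poly (hasse l (blk x j + blk x (J + j) * f ^ h)) a)"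
      by (intro eqm_mult) auto
    also have "\<dots> = (\<Sum>j<J. (a ^ q) ^ j * (poly f a ^ l * poly (hasse l (blk x j + blk x (J + j) * f ^ h)) a))"
      by (simp add: sum_distrib_left power_mult mult.left_commute)
    also have "\<dots> \<sim> (\<Sum>j<J. a ^ j * poly (hasse l (blk x j) * f ^ l - V l (blk x (J + j))) a)"
    proof (intro eqm_sum eqm_mult eqm_power)
      show "a ^ q \<sim> a" using power_q by (simp add: eqm_def)
      fix j
      have "f ^ l * hasse l (f ^ h * s) = f ^ h * V l s" for s
      proof -
        have "f ^ l * hasse l (f ^ h * s) = (\<Sum>i\<le>l. f ^ l * (f ^ (h - i) * W i * hasse (l - i) s))"
          by (simp add: hasse_mult W(2) sum_distrib_left)
        also have "\<dots> = (\<Sum>i\<le>l. f ^ h * (hasse (l - i) s * f ^ (l - i) * W i))"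
        proof (rule sum.cong)
          fix i assume "i \<in> {..l}"
          then have "f ^ l * f ^ (h - i) = f ^ h * f ^ (l - i)"
            using l that by (simp add: add.commute flip: power_add)
          then have "f ^ l * f ^ (h - i) * (W i * hasse (l - i) s) =
              f ^ h * f ^ (l - i) * (W i * hasse (l - i) s)" by simp
          then show "f ^ l * (f ^ (h - i) * W i * hasse (l - i) s) =
              f ^ h * (hasse (l - i) s * f ^ (l - i) * W i)"
            by (simp only: ac_simps)
        qed simp
        finally show ?thesis by (simp add: V_def sum_distrib_left)
      qed
      then have "f ^ l * hasse l (blk x j + blk x (J + j) * f ^ h) =
          hasse l (blk x j) * f ^ l + f ^ h * V l (blk x (J + j))"
        by (simp add: hasse_add distrib_left mult.commute[of _ "f ^ h"])
      then have "poly f a ^ l * poly (hasse l (blk x j + blk x (J + j) * f ^ h)) a =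
          poly (hasse l (blk x j) * f ^ l) a + poly f a ^ h * poly (V l (blk x (J + j))) a"
        by (metis poly_add poly_mult poly_power)
      also have "\<dots> \<sim> poly (hasse l (blk x j) * f ^ l) a + - 1 * poly (V l (blk x (J + j))) a"
        by (intro eqm_add eqm_mult fa) auto
      finally show "poly f a ^ l * poly (hasse l (blk x j + blk x (J + j) * f ^ h)) a \<sim>
          poly (hasse l (blk x j) * f ^ l - V l (blk x (J + j))) a"
        by simp
    qed
    also have "\<dots> = poly (E x l) a"
      by (simp add: E_def poly_sum poly_monom)
    finally have "poly f a ^ l * poly (hasse l R) a \<in> I"
      using poly_mem[OF E_mem] that eqm_mem by blast
    then show ?thesis
      using \<open>poly f a \<notin> I\<close> by (simp add: mult_mem_iff power_mem_iff)
  qed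
  show ?thesis
  proof (cases "R \<in> coeffs_in I")
    case True
    obtain j i where ji: "u = (j, i)" "j < 2 * J" "i \<le> D" using u by auto
    have "coeff (blk x j) i = x (j, i)"
      using ji by (simp add: blk_def coeff_sum)
    then have nm: "blk x j \<notin> coeffs_in I"
      using u ji by (auto simp: coeffs_in_def intro!: exI[of _ i])
    have "\<exists>j<J. blk x j \<notin> coeffs_in I \<or> blk x (J + j) \<notin> coeffs_in I"
    proof (cases "j < J")
      case False
      then have "j - J < J" "J + (j - J) = j" using ji by auto
      then show ?thesis using nm by metis
    qed (use nm in auto)
    then obtain j where "j < J" "blk x j \<notin> coeffs_in I \<or> blk x (J + j) \<notin> coeffs_in I"
      by blast
    then have "card Z \<le> D"
      using True unfolding Z_def R_def
      by (intro stepanov_nonvanishing[OF f0 deg_f DJ(1), of "blk x" "\<lambda>j. blk x (J + j)" j J] deg_blk)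
    then show ?thesis by (simp add: Z_def)
  next
    case False
    have "sum (\<lambda>_. L) Z \<le> degree R"
      using False finite_T rep_unique van by (intro root_count) (auto simp: Z_def)
    also have "degree R \<le> q * (J - 1) + (D + d * h)"
      unfolding R_def
    proof (intro degree_sum_le)
      fix j assume "j \<in> {..<J}"
      then have "q * j \<le> q * (J - 1)" by (intro mult_le_mono) auto
      then have "degree (monom (1::'r) (q * j)) \<le> q * (J - 1)"
        using degree_monom_le le_trans by blast
      moreover have "degree (f ^ h) \<le> d * h"
        using degree_power_le[of f h] deg_f by (meson le_trans mult_le_mono1)
      then have "degree (blk x j + blk x (J + j) * f ^ h) \<le> D + d * h"
        using deg_blk[of x] by (intro degree_add_le degree_mult_le[THEN le_trans] add_mono)
          (auto intro: trans_le_add1)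
      ultimately show "degree (monom 1 (q * j) * (blk x j + blk x (J + j) * f ^ h)) \<le> q * (J - 1) + (D + d * h)"
        by (intro degree_mult_le[THEN le_trans] add_mono)
    qed simp
    finally show ?thesis by (simp add: Z_def algebra_simps)
  qed
qed

end

section \<open>Choice of parameters in Stepanov's bound\<close>

lemma two_sum_linear: "2 * (\<Sum>l<n. D + c * l) + c * n = 2 * n * D + c * n * n" for n :: nat
  by (induction n) (simp_all add: algebra_simps)

text \<open>The parameters are the integer part \<open>L\<close> of sqrt q, the largest
  \<open>D\<close> with 2 D + d < q and the least \<open>J\<close> that meets the counting
  condition. Twice the cardinality is then at most q + (d + 1) q / L + d q L / y, with L close to
  sqrt q and y close to q.\<close>

lemma (in finite_residue_field) card_nonsquare_le:
  assumes f0: "poly f 0 = 1" and deg_f: "degree f \<le> d" and d: "d > 0"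
    and big: "2 * real d \<le> sqrt q" "sqrt q \<ge> 10"
  shows "2 * real (card {a \<in> T. poly f a ^ h + 1 \<in> I}) \<le> q + (2 * d + 3) * sqrt q"
proof -
  define N where "N = card {a \<in> T. poly f a ^ h + 1 \<in> I}"
  define s where "s = sqrt q"
  have s: "s \<ge> 10" "s * s = q" "2 * real d \<le> s" using big by (auto simp: s_def)
  define L where "L = nat \<lfloor>s\<rfloor>"
  have L: "real L \<le> s" "s - 1 \<le> real L" using s(1) unfolding L_def by linarith+
  then have L_pos: "L > 0" using s(1) by (cases L) auto
  have "10 * s \<le> s * s" using s(1) by (intro mult_right_mono) auto
  then have sq: "10 * s \<le> q" using s(2) by simp
  have "d < q" using sq s by linarith
  have "L \<le> h" using sq s L q_eq_h by linarith
  define D where "D = (q - 1 - d) div 2"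
  have D: "2 * D + d < q" "q \<le> 2 * (D + 1) + d"
    using \<open>d < q\<close> unfolding D_def by presburger+
  define X where "X = (\<Sum>l<L. D + (d - 1) * l)"
  \<comment> \<open>Moving the part \<open>L * J\<close> of the conditions to the other side turns
    the counting condition into \<open>X < J * y\<close>.\<close>
  define y where "y = 2 * (D + 1) - L"
  have "d + L < q" using sq s L by linarith
  then have y: "2 * (D + 1) = y + L" "q - d - L \<le> y" "y > 0"
    using D unfolding y_def by linarith+
  define J where "J = X div y + 1"
  have "X < J * y"
    unfolding J_def using dividend_less_div_times[OF y(3), of X] by (simp add: add.commute)
  have count: "(\<Sum>l<L. D + J + (d - 1) * l) < 2 * (D + 1) * J"
  proof -
    have "(\<Sum>l<L. D + J + (d - 1) * l) = X + L * J"
      by (simp add: X_def sum.distrib add_mult_distrib2)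
    then show ?thesis using \<open>X < J * y\<close> y(1) by (simp add: algebra_simps)
  qed
  have "N \<le> D \<or> L * N \<le> D + d * h + q * (J - 1)"
    unfolding N_def by (rule stepanov[OF f0 deg_f d D(1) _ \<open>L \<le> h\<close> count]) (simp add: J_def)
  then show ?thesis
  proof
    assume "N \<le> D"
    then have "2 * real N \<le> q" using D(1) by linarith
    also have "\<dots> \<le> q + (2 * d + 3) * sqrt q" by simp
    finally show ?thesis by (simp add: N_def)
  next
    assume N: "L * N \<le> D + d * h + q * (J - 1)"
    define j where "j = real (J - 1)"
    have "(J - 1) * y \<le> X" by (simp add: J_def)
    then have "j * real y \<le> real X"
      unfolding j_def of_nat_mult[symmetric] of_nat_le_iff .
    moreover have "2 * real X \<le> real L * (y + d * L)"
    proof -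
      have "2 * X + (d - 1) * L = 2 * L * D + (d - 1) * L * L"
        unfolding X_def by (rule two_sum_linear)
      then have "2 * X \<le> L * (2 * D + (d - 1) * L)" by (simp add: algebra_simps)
      also have "\<dots> \<le> L * (y + d * L)"
      proof (intro mult_le_mono2)
        have "d * L = (d - 1) * L + L" using d by (cases d) auto
        moreover have "2 * D \<le> y + L" unfolding y(1)[symmetric] by simp
        ultimately show "2 * D + (d - 1) * L \<le> y + d * L"
          by (metis add.assoc add.commute add_le_cancel_right)
      qed
      finally have "2 * X \<le> L * (y + d * L)" .
      from of_nat_mono[OF this, where 'a = real] show ?thesis by simp
    qed
    ultimately have j: "2 * j * y \<le> real L * real (y + d * L)" by linarith
    have jL: "2 * q * j / L \<le> q + d * (q * L / y)"
    proof -
      have "2 * j \<le> L * (1 + d * L / y)"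
        using j y(3) by (simp add: field_simps)
      then have "2 * j / L \<le> 1 + d * L / y"
        using L_pos by (simp add: divide_le_eq mult.commute)
      then have "q * (2 * j / L) \<le> q * (1 + d * L / y)" by (intro mult_left_mono) auto
      then show ?thesis by (simp add: algebra_simps)
    qed
    have "real L * N \<le> D + d * h + q * j"
      using of_nat_mono[OF N, where 'a = real] by (simp add: j_def)
    moreover have "2 * real D + 2 * (d * h) \<le> (d + 1) * q"
    proof -
      have "2 * D + 2 * (d * h) \<le> q + d * q" 
        using D(1) q_eq_h by (intro add_mono) (auto simp: algebra_simps)
      then have "2 * D + 2 * (d * h) \<le> (d + 1) * q" by simp
      from of_nat_mono[OF this, where 'a = real] show ?thesis by simp
    qed
    ultimately have "2 * real N * L \<le> (d + 1) * q + 2 * q * j"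
      by (simp add: algebra_simps)
    then have "2 * real N \<le> ((d + 1) * q + 2 * q * j) / L"
      using L_pos by (simp add: pos_le_divide_eq)
    also have "\<dots> = (d + 1) * (q / L) + 2 * q * j / L"
      by (simp add: add_divide_distrib algebra_simps)
    \<comment> \<open>For s >= 10, s + 1.2 bounds q / L because L >= s - 1, and s + 1.8 bounds q L /
      y because y >= q - 1.5 s. The surplus 3 d + 1.2 is absorbed by 2 s below, through 2 d <=
      s.\<close>
    also have "\<dots> \<le> (d + 1) * (s + 1.2) + (q + d * (s + 1.8))"
    proof (intro add_mono mult_left_mono order_trans[OF jL] order_refl)
      have "s * 10 \<le> s * s" using s by (intro mult_left_mono) auto
      then have "q \<le> (s + 1.2) * (s - 1)"
        using s by (simp add: algebra_simps)
      also have "\<dots> \<le> (s + 1.2) * L" using L s by (intro mult_left_mono) auto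
      finally show "q / L \<le> s + 1.2" using L_pos by (simp add: divide_le_eq)
      have "q - 1.5 * s \<le> y" using y(2) s L by linarith
      have "real q * real L \<le> q * s" using L by (intro mult_left_mono) auto
      also have "q * s \<le> (s + 1.8) * (q - 1.5 * s)"
        using \<open>s * 10 \<le> s * s\<close> s(1) unfolding s(2)[symmetric] by (simp add: algebra_simps)
      also have "\<dots> \<le> (s + 1.8) * y" using \<open>q - 1.5 * s \<le> y\<close> s by (intro mult_left_mono) auto
      finally show "real (q * L) / y \<le> s + 1.8" using y(3) by (simp add: divide_le_eq)
    qed auto
    also have "\<dots> = q + (2 * d + 1) * s + 3 * d + 1.2" by (simp add: field_simps)
    also have "\<dots> \<le> q + (2 * d + 3) * s" using s by (simp add: algebra_simps)
    finally show ?thesis by (simp add: N_def s_def)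
  qed
qed

section \<open>Character sums\<close>

text \<open>Each subset is paired with its complement.\<close>

lemma sum_Pow_sum:
  fixes w :: "'b \<Rightarrow> real"
  assumes "finite K"
  shows "2 * (\<Sum>S\<in>Pow K. sum w S) = 2 ^ card K * sum w K"
proof -
  have "(\<Sum>S\<in>Pow K. sum w S) = (\<Sum>S\<in>Pow K. sum w (K - S))"
    by (rule sum.reindex_bij_witness[of _ "\<lambda>S. K - S" "\<lambda>S. K - S"]) (auto intro!: arg_cong[of _ _ "sum w"])
  then have "2 * (\<Sum>S\<in>Pow K. sum w S) = (\<Sum>S\<in>Pow K. sum w S + sum w (K - S))"
    by (simp add: sum.distrib)
  also have "\<dots> = (\<Sum>S\<in>Pow K. sum w K)"
    using assms by (intro sum.cong) (auto simp: sum.subset_diff[of _ K w])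
  finally show ?thesis using assms by (simp add: card_Pow)
qed

context finite_residue_field
begin

text \<open>The quadratic character of the residue field, expressed by Euler's criterion.\<close>

definition chi :: "'r \<Rightarrow> real" where
  "chi x = (if x \<in> I then 0 else if x ^ h - 1 \<in> I then 1 else - 1)"

lemma signs_disjoint: "\<not> (x - 1 \<in> I \<and> x + 1 \<in> I)"
  using diff_mem[of "x + 1" "x - 1"] two_nmem by auto

lemma chi_mult: "chi (x * y) = chi x * chi y"
proof (cases "x \<in> I \<or> y \<in> I")
  case False
  have eq: "chi z = 1 \<longleftrightarrow> z ^ h \<sim> 1" "chi z = - 1 \<longleftrightarrow> z ^ h \<sim> - 1" if "z \<notin> I" for z
    using that power_h_cases[of z] signs_disjoint[of "z ^ h"] by (auto simp: chi_def eqm_def)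
  have xy: "x * y \<notin> I" using False by (simp add: mult_mem_iff)
  have "chi z = 1 \<or> chi z = - 1" if "z \<notin> I" for z
    using that by (auto simp: chi_def)
  then consider "chi x = 1" "chi y = 1" | "chi x = 1" "chi y = - 1"
    | "chi x = - 1" "chi y = 1" | "chi x = - 1" "chi y = - 1"
    using False by blast
  then show ?thesis
  proof cases
    case 1
    then have "(x * y) ^ h \<sim> 1"
      using eqm_mult[of "x ^ h" "1" "y ^ h" "1"] eq(1)[of x] eq(1)[of y] False
      by (simp add: power_mult_distrib)
    then have "chi (x * y) = 1" using eq(1)[OF xy] by simp
    then show ?thesis using 1 by simp
  next
    case 2
    then have "(x * y) ^ h \<sim> - 1"
      using eqm_mult[of "x ^ h" "1" "y ^ h" "- 1"] eq(1)[of x] eq(2)[of y] False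
      by (simp add: power_mult_distrib)
    then have "chi (x * y) = - 1" using eq(2)[OF xy] by simp
    then show ?thesis using 2 by simp
  next
    case 3
    then have "(x * y) ^ h \<sim> - 1"
      using eqm_mult[of "x ^ h" "- 1" "y ^ h" "1"] eq(2)[of x] eq(1)[of y] False
      by (simp add: power_mult_distrib)
    then have "chi (x * y) = - 1" using eq(2)[OF xy] by simp
    then show ?thesis using 3 by simp
  next
    case 4
    then have "(x * y) ^ h \<sim> 1"
      using eqm_mult[of "x ^ h" "- 1" "y ^ h" "- 1"] eq(2)[of x] eq(2)[of y] False
      by (simp add: power_mult_distrib)
    then have "chi (x * y) = 1" using eq(1)[OF xy] by simp
    then show ?thesis using 4 by simp
  qed
qed (auto simp: chi_def mult_mem_iff)

lemma chi_1: "chi 1 = 1"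
  by (simp add: chi_def)

lemma chi_prod: "chi (prod g S) = (\<Prod>x\<in>S. chi (g x))"
  by (induction S rule: infinite_finite_induct) (simp_all add: chi_mult chi_1)

lemma card_roots_le:
  assumes "P \<notin> coeffs_in I"
  shows "card {a \<in> T. poly P a \<in> I} \<le> degree P"
proof -
  have "sum (\<lambda>_. 1) {a \<in> T. poly P a \<in> I} \<le> degree P"
    using assms finite_T rep_unique by (intro root_count) auto
  then show ?thesis by simp
qed

text \<open>The sum is \<open>q\<close> minus the number of zeros minus twice the number of
  non-square values. The at most \<open>d\<close> zeros raise the constant 3 of
  \<open>card_nonsquare_le\<close> to 4.\<close>

lemma sum_chi_ge:
  assumes f0: "poly f 0 = 1" and deg_f: "degree f \<le> d" and d: "d > 0"
    and big: "2 * real d \<le> sqrt q" "sqrt q \<ge> 10"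
  shows "(\<Sum>a\<in>T. chi (poly f a)) \<ge> - ((2 * real d + 4) * sqrt q)"
proof -
  have "f \<notin> coeffs_in I" using poly_mem[of f 0] f0 by auto
  then have zeros: "card {a \<in> T. poly f a \<in> I} \<le> d"
    using card_roots_le deg_f le_trans by blast
  have "(\<Sum>a\<in>T. 1 - (if poly f a \<in> I then 1 else 0) - 2 * (if poly f a ^ h + 1 \<in> I then 1 else 0))
      \<le> (\<Sum>a\<in>T. chi (poly f a))"
    using power_h_cases by (intro sum_mono) (auto simp: chi_def)
  moreover have "(\<Sum>a\<in>T. 1 - (if poly f a \<in> I then 1 else 0) - 2 * (if poly f a ^ h + 1 \<in> I then 1 else 0)) =
      real q - card {a \<in> T. poly f a \<in> I} - 2 * real (card {a \<in> T. poly f a ^ h + 1 \<in> I})"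
    unfolding sum_subtractf sum_distrib_left[symmetric]
    using finite_T card_T by (simp add: sum.If_cases Int_def)
  ultimately have "real q - d - (q + (2 * real d + 3) * sqrt q) \<le> (\<Sum>a\<in>T. chi (poly f a))"
    using zeros card_nonsquare_le[OF assms] by linarith
  moreover have "real q - d - (q + (2 * real d + 3) * sqrt q) \<ge> - ((2 * real d + 4) * sqrt q)"
    using big by (simp add: algebra_simps)
  ultimately show ?thesis by linarith
qed

text \<open>In the expansion over subsets of \<open>K\<close> the empty set contributes
  \<open>q\<close>, and \<open>sum_chi_ge\<close> bounds every other term below. If no
  \<open>u\<close> outside \<open>B\<close> were suitable, the product could be nonzero only on
  \<open>B\<close> and at the at most \<open>e\<close> roots of \<open>f K\<close>, where it is at
  most \<open>2 ^ card K\<close>; this contradicts \<open>large\<close>.\<close>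

theorem simultaneous_squares:
  fixes c :: 'r and K :: "nat set"
  assumes K: "finite K" "\<And>k. k \<in> K \<Longrightarrow> k > 0" and B: "B \<subseteq> T"
    and e: "e = (\<Sum>k\<in>K. 2 * k)" "2 * real e \<le> sqrt q" "sqrt q \<ge> 10"
    and large: "2 ^ card K * ((e + 4) * sqrt q + e + card B) < q"
  obtains u where "u \<in> T - B" "\<And>k. k \<in> K \<Longrightarrow> (1 + c * u ^ (2 * k)) ^ h - 1 \<in> I"
proof -
  define g where "g k u = 1 + c * u ^ (2 * k)" for k u
  define f where "f S = (\<Prod>k\<in>S. 1 + monom c (2 * k))" for S
  have poly_f: "poly (f S) u = (\<Prod>k\<in>S. g k u)" for S u
    by (simp add: f_def g_def poly_prod poly_monom)
  have f0: "poly (f S) 0 = 1" if "S \<subseteq> K" for S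
    unfolding poly_f g_def using K(2) that by (intro prod.neutral) (auto simp: power_0_left)
  have deg_f: "degree (f S) \<le> (\<Sum>k\<in>S. 2 * k)" if "S \<subseteq> K" for S
  proof -
    have "degree (1 + monom c (2 * k)) \<le> 2 * k" for k
      by (intro degree_add_le) (auto intro: degree_monom_le)
    then have "sum (degree \<circ> (\<lambda>k. 1 + monom c (2 * k))) S \<le> (\<Sum>k\<in>S. 2 * k)"
      by (intro sum_mono) simp
    then show ?thesis
      unfolding f_def using degree_prod_sum_le[of S "\<lambda>k. 1 + monom c (2 * k)"] K(1) that
      by (meson finite_subset le_trans)
  qed
  define Z where "Z = {u \<in> T. poly (f K) u \<in> I}"
  have "f K \<notin> coeffs_in I" using poly_mem[of "f K" 0] f0[of K] by auto
  then have "card Z \<le> e"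
    unfolding Z_def using card_roots_le deg_f[of K] e(1) le_trans by blast
  have lower: "- ((2 * (\<Sum>k\<in>S. 2 * real k) + 4) * sqrt q) \<le> (\<Sum>u\<in>T. chi (poly (f S) u))"
    if "S \<subseteq> K" "S \<noteq> {}" for S
  proof -
    have "finite S" using K(1) that finite_subset by blast
    have "(\<Sum>k\<in>S. 2 * k) \<le> e" unfolding e(1) using K(1) that by (intro sum_mono2) auto
    then have "2 * real (\<Sum>k\<in>S. 2 * k) \<le> sqrt q" using e(2) by linarith
    moreover have "(\<Sum>k\<in>S. 2 * k) > 0"
      using that K(2) \<open>finite S\<close> by (intro sum_pos) auto
    ultimately show ?thesis
      using sum_chi_ge[OF f0 deg_f, of S] that e(3) by simp
  qed
  have "(\<Sum>u\<in>T. \<Prod>k\<in>K. 1 + chi (g k u)) = (\<Sum>S\<in>Pow K. \<Sum>u\<in>T. chi (poly (f S) u))"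
    by (subst sum.swap, rule sum.cong) (simp_all add: prod_add[OF K(1)] add.commute[of 1] poly_f chi_prod)
  also have "\<dots> = (\<Sum>u\<in>T. chi (poly (f {}) u)) + (\<Sum>S\<in>Pow K - {{}}. \<Sum>u\<in>T. chi (poly (f S) u))"
    using K(1) by (subst sum.remove[of _ "{}"]) auto
  finally have W: "(\<Sum>u\<in>T. \<Prod>k\<in>K. 1 + chi (g k u)) =
      real q + (\<Sum>S\<in>Pow K - {{}}. \<Sum>u\<in>T. chi (poly (f S) u))"
    by (simp add: f_def chi_1 card_T)
  define w where "w S = (2 * (\<Sum>k\<in>S. 2 * real k) + 4) * sqrt q" for S :: "nat set"
  have "(\<Sum>S\<in>Pow K - {{}}. - w S) \<le> (\<Sum>S\<in>Pow K - {{}}. \<Sum>u\<in>T. chi (poly (f S) u))"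
    using lower by (intro sum_mono) (auto simp: w_def)
  moreover have "sum w (Pow K - {{}}) \<le> sum w (Pow K)"
    using K(1) by (intro sum_mono2) (auto simp: w_def)
  moreover have "sum w (Pow K) = (2 * (\<Sum>S\<in>Pow K. \<Sum>k\<in>S. 2 * real k) + 4 * 2 ^ card K) * sqrt q"
    using K(1) by (simp add: w_def sum.distrib card_Pow flip: sum_distrib_right sum_distrib_left)
  \<comment> \<open>On average a subset has half of the total degree, which cancels the factor 2 in
    \<open>lower\<close>.\<close>
  moreover have "2 * (\<Sum>S\<in>Pow K. \<Sum>k\<in>S. 2 * real k) + 4 * 2 ^ card K = 2 ^ card K * (real e + 4)"
    unfolding sum_Pow_sum[OF K(1)] e(1) by (simp add: algebra_simps)
  ultimately have W: "real q - 2 ^ card K * (real e + 4) * sqrt q \<le> (\<Sum>u\<in>T. \<Prod>k\<in>K. 1 + chi (g k u))"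
    unfolding W sum_negf by simp
  have "\<exists>u\<in>T - B. \<forall>k\<in>K. g k u ^ h - 1 \<in> I"
  proof (rule ccontr)
    assume none: "\<not> ?thesis"
    \<comment> \<open>Off \<open>B \<union> Z\<close> every factor is 0 or 2, and by
      \<open>none\<close> at least one is 0.\<close>
    have "(\<Sum>u\<in>T. \<Prod>k\<in>K. 1 + chi (g k u)) \<le> (\<Sum>u\<in>T. if u \<in> B \<union> Z then 2 ^ card K else 0)"
    proof (rule sum_mono)
      fix u assume u: "u \<in> T"
      show "(\<Prod>k\<in>K. 1 + chi (g k u)) \<le> (if u \<in> B \<union> Z then 2 ^ card K else 0)"
      proof (cases "u \<in> B \<union> Z")
        case True
        have "(\<Prod>k\<in>K. 1 + chi (g k u)) \<le> (\<Prod>k\<in>K. 2)"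
          by (rule prod_mono) (auto simp: chi_def)
        then show ?thesis using True by simp
      next
        case False
        then have "\<And>k. k \<in> K \<Longrightarrow> g k u \<notin> I"
          using u K(1) by (auto simp: Z_def poly_f prod_mem_iff)
        moreover obtain k where "k \<in> K" "g k u ^ h - 1 \<notin> I" using none False u by blast
        ultimately have "1 + chi (g k u) = 0" by (simp add: chi_def)
        then have "(\<Prod>k\<in>K. 1 + chi (g k u)) = 0"
          using K(1) \<open>k \<in> K\<close> by (intro prod_zero) auto
        then show ?thesis using False by simp
      qed
    qed
    also have "\<dots> = 2 ^ card K * real (card (B \<union> Z))"
    proof -
      have "T \<inter> {u. u \<in> B \<union> Z} = B \<union> Z" using B by (auto simp: Z_def)
      then show ?thesis using finite_T by (simp only: sum.If_cases) simp
    qed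
    also have "\<dots> \<le> 2 ^ card K * (real e + card B)"
      using \<open>card Z \<le> e\<close> card_Un_le[of B Z] by (intro mult_left_mono) auto
    finally show False using W large by (simp add: algebra_simps)
  qed
  then show ?thesis using that by (auto simp: g_def)
qed

end

section \<open>Finite fields as quotients of the integer polynomials\<close>

context finite_residue_field
begin

text \<open>For i = p j the p-th power of 1 + c u^(2 j) is 1 + c u^(2 i) modulo \<open>I\<close>,
  since c^2 = 1 and p odd give c^p = c. The property thus passes from j to i.\<close>

lemma frobenius_multiples:
  assumes c: "c * c = 1"
    and cond: "\<And>k. k \<in> {1..m} \<Longrightarrow> \<not> p dvd k \<Longrightarrow> (1 + c * u ^ (2 * k)) ^ h - 1 \<in> I"
    and "i \<in> {1..m}"
  shows "(1 + c * u ^ (2 * i)) ^ h - 1 \<in> I"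
  using assms(3)
proof (induction i rule: less_induct)
  case (less i)
  show ?case
  proof (cases "p dvd i")
    case True
    then obtain j where j: "i = p * j" by blast
    have "j > 0" using j less.prems by (cases j) auto
    moreover have "p > 1" using prime_p prime_gt_1_nat by blast
    ultimately have "j < i" using j by simp
    then have IH: "(1 + c * u ^ (2 * j)) ^ h \<sim> 1"
      using less \<open>j > 0\<close> by (auto simp: eqm_def)
    have "odd p"
    proof
      assume "even p"
      then have "p = 2" using prime_p primes_dvd_imp_eq two_is_prime_nat by blast
      then have "q = 1 \<or> even q" unfolding q_eq by (cases k) auto
      then show False using q_gt_1 q_eq_h by auto
    qed
    then obtain n where "p = 2 * n + 1" by (auto elim: oddE)
    then have "c ^ p = c" using c by (simp add: power_mult power2_eq_square)
    then have "(1 + c * u ^ (2 * j)) ^ p \<sim> 1 + c * u ^ (2 * i)"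
      using freshman[OF prime_p p_mem, of 1 "c * u ^ (2 * j)" 1]
      by (simp add: j power_mult_distrib mult_ac flip: power_mult)
    then have "((1 + c * u ^ (2 * j)) ^ p) ^ h \<sim> (1 + c * u ^ (2 * i)) ^ h"
      by (rule eqm_power)
    moreover have "((1 + c * u ^ (2 * j)) ^ h) ^ p \<sim> 1"
      using eqm_power[OF IH, of p] by simp
    ultimately have "(1 + c * u ^ (2 * i)) ^ h \<sim> 1"
      using eqm_sym eqm_trans by (metis power_commutes power_mult mult.commute)
    then show ?thesis by (simp add: eqm_def)
  qed (use cond less.prems in blast)
qed

end

section \<open>Evaluation of integer polynomials in a commutative ring\<close>

context cring
begin

text \<open>The homomorphism from Z[X] that maps X to \<open>x\<close>. When \<open>x\<close>
  generates the multiplicative group of a finite field, its kernel is the prime ideal for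
  \<open>finite_residue_field\<close>.\<close>

definition int_poly_eval :: "'a \<Rightarrow> int poly \<Rightarrow> 'a" where
  "int_poly_eval x P = fold_coeffs (\<lambda>a y. [a] \<cdot> \<one> \<oplus> x \<otimes> y) P \<zero>"

context
  fixes x assumes x [simp]: "x \<in> carrier R"
begin

lemma int_poly_eval_0 [simp]: "int_poly_eval x 0 = \<zero>"
  by (simp add: int_poly_eval_def)

lemma int_poly_eval_pCons [simp]:
  "int_poly_eval x (pCons a P) = [a] \<cdot> \<one> \<oplus> x \<otimes> int_poly_eval x P"
proof (cases "a = 0 \<and> P = 0")
  case True
  then show ?thesis by (simp add: add_pow_def int_pow_def2)
next
  case False
  then show ?thesis by (cases "a = 0") (auto simp: int_poly_eval_def)
qed

lemma int_poly_eval_closed [simp]: "int_poly_eval x P \<in> carrier R"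
  by (induction P) auto

lemma add_pow_int_add: "[(a + b :: int)] \<cdot> \<one> = [a] \<cdot> \<one> \<oplus> [b] \<cdot> \<one>"
  using add.int_pow_mult[of \<one> a b] by (simp add: add_pow_def)

lemma add_pow_int_mult: "[(a * b :: int)] \<cdot> \<one> = [a] \<cdot> \<one> \<otimes> [b] \<cdot> \<one>"
  using add.int_pow_pow[of \<one> a b] add_pow_ldistr_int[OF one_closed add.int_pow_closed[OF one_closed, of b], of a]
    add.int_pow_closed[OF one_closed, of b]
  by (simp add: add_pow_def mult.commute)

lemma int_poly_eval_add: "int_poly_eval x (P + Q) = int_poly_eval x P \<oplus> int_poly_eval x Q"
  by (induction P Q rule: poly_induct2) (simp_all add: add_pow_int_add r_distr a_ac)

lemma int_poly_eval_smult: "int_poly_eval x (Polynomial.smult a P) = [a] \<cdot> \<one> \<otimes> int_poly_eval x P"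
  by (induction P) (simp_all add: add_pow_int_mult r_distr m_lcomm)

lemma int_poly_eval_mult: "int_poly_eval x (P * Q) = int_poly_eval x P \<otimes> int_poly_eval x Q"
proof (induction P)
  case (pCons a P)
  have "[(0::int)] \<cdot> \<one> = \<zero>" by (simp add: add_pow_def int_pow_def2)
  then show ?case
    using pCons by (simp add: int_poly_eval_add int_poly_eval_smult l_distr m_assoc)
qed simp

lemma int_poly_eval_1 [simp]: "int_poly_eval x 1 = \<one>"
  by (simp add: one_pCons add_pow_def int_pow_def2)

lemma int_poly_eval_power: "int_poly_eval x (P ^ n) = int_poly_eval x P [^] n"
  by (induction n) (simp_all add: int_poly_eval_mult m_comm)

lemma int_poly_eval_diff: "int_poly_eval x (P - Q) = int_poly_eval x P \<ominus> int_poly_eval x Q"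
proof -
  have "int_poly_eval x P = int_poly_eval x (P - Q) \<oplus> int_poly_eval x Q"
    by (simp flip: int_poly_eval_add)
  then show ?thesis by (simp add: minus_eq a_assoc r_neg)
qed

lemma int_poly_eval_of_nat: "int_poly_eval x (of_nat n) = [n] \<cdot> \<one>"
  using add.nat_pow_closed[OF one_closed, of n] by (simp add: of_nat_poly add_pow_def int_pow_int)

end

end

section \<open>Finite fields: characteristic, presentation as a quotient, Euler's criterion\<close>

context field
begin

lemma power_order: 
  assumes "finite (carrier R)" "a \<in> carrier R"
  shows "a [^] order R = a"
proof (cases "a = \<zero>")
  case True
  moreover have "order R > 0" using assms by (simp add: order_gt_0_iff_finite)
  ultimately show ?thesis by (simp add: nat_pow_zero)
next
  case False
  interpret G: group "mult_of R" by (rule field_mult_group)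
  have "a [^] (order R - 1) = \<one>"
    using G.pow_order_eq_1[of a] assms False by (simp add: order_mult_of nat_pow_mult_of)
  moreover have "order R = Suc (order R - 1)"
    using assms by (simp add: order_gt_0_iff_finite)
  ultimately show ?thesis using assms(2) by (metis l_one nat_pow_Suc)
qed

lemma nat_pow_eq_zero: "a \<in> carrier R \<Longrightarrow> a [^] (n::nat) = \<zero> \<Longrightarrow> a = \<zero>"
  by (induction n) (auto simp: integral_iff)

text \<open>Lagrange's theorem in the additive group kills p^k times the unit. This is the k-th
  power of p times the unit, and a field has no nonzero nilpotents.\<close>

lemma char_power:
  assumes "finite (carrier R)" "order R = p ^ k"
  shows "[p] \<cdot> \<one> = \<zero>"
proof -
  have "add_pow R (order R) \<one> = \<zero>"
    using add.pow_order_eq_1[of \<one>] by (simp add: add_pow_def order_def)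
  moreover have "add_pow R (p ^ k) \<one> = add_pow R p \<one> [^] k"
    using int_poly_eval_power[of \<zero> "of_nat p" k]
    by (simp add: int_poly_eval_of_nat del: of_nat_power flip: of_nat_power)
  ultimately show ?thesis
    using assms(2) add.nat_pow_closed[OF one_closed, of p] nat_pow_eq_zero[of "add_pow R p \<one>" k]
    by (auto simp: add_pow_def)
qed

text \<open>Every nonzero element is a power of a generator \<open>x\<close>, hence the value of a
  power of X, so evaluation is onto. \<open>T\<close> collects one preimage of each element.\<close>

lemma finite_field_residue:
  assumes fin: "finite (carrier R)" and ord: "order R = q" and q: "q = p ^ k" "q = 2 * h + 1"
    and p: "prime p"
  obtains x T where "x \<in> carrier R" "bij_betw (int_poly_eval x) T (carrier R)"
    "finite_residue_field {P. int_poly_eval x P = \<zero>} T p k q h"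
proof -
  obtain x where x: "x \<in> carrier R" and gen: "carrier R - {\<zero>} = {x [^] i |i. i \<in> (UNIV::nat set)}"
    using finite_field_mult_group_has_gen[OF fin] by auto
  let ?\<phi> = "int_poly_eval x"
  have "\<exists>P. ?\<phi> P = y" if y: "y \<in> carrier R" for y
  proof (cases "y = \<zero>")
    case False
    then obtain i :: nat where i: "y = x [^] i" using gen y by blast
    have "?\<phi> [:0, 1:] = x" using x by (simp add: add_pow_def int_pow_def2)
    then show ?thesis using i int_poly_eval_power[OF x] by metis
  qed (use x in \<open>auto intro: exI[of _ 0]\<close>)
  then obtain s where s: "\<And>y. y \<in> carrier R \<Longrightarrow> ?\<phi> (s y) = y" by metis
  define T where "T = s ` carrier R"
  have bij: "bij_betw ?\<phi> T (carrier R)"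
    using s x by (auto simp: T_def bij_betw_def inj_on_def image_iff)
  moreover have "finite_residue_field {P. ?\<phi> P = \<zero>} T p k q h"
  proof
    show "finite T" using fin by (simp add: T_def)
    show "card T = q" using bij_betw_same_card[OF bij] ord by (simp add: order_def)
    show "\<exists>t\<in>T. P - t \<in> {P. ?\<phi> P = \<zero>}" for P
      using s x by (auto simp: T_def int_poly_eval_diff intro!: bexI[of _ "?\<phi> P"])
    show "t = u" if "t \<in> T" "u \<in> T" "t - u \<in> {P. ?\<phi> P = \<zero>}" for t u
      using that x bij by (auto simp: int_poly_eval_diff bij_betw_def inj_on_def)
    show "of_nat p \<in> {P. ?\<phi> P = \<zero>}"
      using x char_power[OF fin] ord q by (simp add: int_poly_eval_of_nat)
    show "P ^ q - P \<in> {P. ?\<phi> P = \<zero>}" for P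
      using power_order[OF fin, of "?\<phi> P"] x ord
      by (simp add: int_poly_eval_diff int_poly_eval_power)
  qed (use x p q in \<open>auto simp: int_poly_eval_add int_poly_eval_mult integral_iff\<close>)
  ultimately show ?thesis using that x by blast
qed

text \<open>A generator x has order 2 h, so for y = x^i the equation y^h = 1 means that 2 h divides
  i h, and i is even.\<close>

lemma euler_square:
  assumes fin: "finite (carrier R)" and ord: "order R = 2 * h + 1" and y: "y \<in> carrier R" "y [^] h = \<one>"
  shows "\<exists>z\<in>carrier R. y = z [^] (2::nat)"
proof -
  interpret G: group "mult_of R" by (rule field_mult_group)
  have fin': "finite (carrier (mult_of R))" using fin by simp
  obtain x where x: "x \<in> carrier (mult_of R)" and gen: "carrier (mult_of R) = {x [^] i |i. i \<in> (UNIV::nat set)}"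
    using finite_field_mult_group_has_gen[OF fin] by auto
  have "generate (mult_of R) {x} = carrier (mult_of R)"
    unfolding gen G.generate_pow_on_finite_carrier[OF fin' x] nat_pow_mult_of ..
  then have ordx: "G.ord x = 2 * h"
    using G.generate_pow_card[OF x] order_mult_of[OF fin] ord by (simp add: order_def)
  have "card {\<zero>, \<one>} \<le> order R" unfolding order_def using fin by (intro card_mono) auto
  then have "h > 0" using ord by simp
  then have "y \<noteq> \<zero>" using y by (auto simp: nat_pow_zero)
  then obtain i :: nat where i: "y = x [^] i" using gen y by auto
  then have "x [^]\<^bsub>mult_of R\<^esub> (i * h) = \<one>\<^bsub>mult_of R\<^esub>"
    using y x by (simp add: nat_pow_mult_of nat_pow_pow)
  then have "2 * h dvd i * h" using G.pow_eq_id[OF x] ordx by simp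
  then have "even i" using \<open>h > 0\<close> by simp
  then obtain j where "i = j * 2" by (metis dvd_mult_div_cancel mult.commute)
  then have "y = (x [^] j) [^] (2::nat)" using i x by (simp add: nat_pow_pow)
  then show ?thesis using x by auto
qed

end

text \<open>Gauss's lemma with p = 8 m + 7: among the numbers 2 x with 1 <= x <= 4 m + 3, those
  exceeding (p - 1) / 2 = 4 m + 3 have x >= 2 m + 2. There are 2 (m + 1) of them, an even
  number.\<close>

lemma two_QuadRes:
  fixes p :: nat
  assumes "prime p" "p mod 8 = 7"
  shows "\<exists>y. int p dvd y\<^sup>2 - 2"
proof -
  define m where "m = int (p div 8)"
  have p: "int p = 8 * m + 7" unfolding m_def using assms(2) by presburger
  have "p > 2" using assms(2) by presburger
  have m: "m \<ge> 0" by (simp add: m_def)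
  interpret GAUSS p 2
  proof
    show "[2 \<noteq> 0] (mod int p)" using m by (auto simp: cong_0_iff p dest: zdvd_imp_le)
  qed (use assms \<open>p > 2\<close> in auto)
  have half: "(int p - 1) div 2 = 4 * m + 3" using p by simp
  have "C = (\<lambda>x. 2 * x) ` {1..4 * m + 3}"
  proof -
    have "C = (\<lambda>x. (x * 2) mod int p) ` {0<..4 * m + 3}"
      unfolding C_def B_def A_def half by (simp add: image_image)
    also have "\<dots> = (\<lambda>x. 2 * x) ` {1..4 * m + 3}"
      using p m by (intro image_cong) auto
    finally show ?thesis .
  qed
  then have "E = (\<lambda>x. 2 * x) ` {2 * m + 2..4 * m + 3}"
    unfolding E_def half using m by (auto simp: image_iff)
  then have "card E = card {2 * m + 2..4 * m + 3}"
    by (simp add: card_image inj_on_def)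
  also have "\<dots> = 2 * nat (m + 1)" using m by simp
  finally have "Legendre 2 (int p) = 1" using gauss_lemma by simp
  then show ?thesis
    by (auto simp: Legendre_def QuadRes_def cong_iff_dvd_diff split: if_splits)
qed

section \<open>Diophantine tuples from geometric progressions\<close>

context field
begin

lemma max_diophantine_ge:
  assumes "finite (carrier R)" "diophantine_tuple R S"
  shows "max_diophantine R \<ge> card S"
proof -
  have "{card S | S. diophantine_tuple R S} \<subseteq> card ` Pow (carrier R)"
    by (auto simp: diophantine_tuple_def)
  then have "finite {card S | S. diophantine_tuple R S}"
    using assms(1) finite_surj by blast
  then show ?thesis
    unfolding max_diophantine_def using assms(2) by (intro Max_ge) auto
qed

lemma square_mult:
  assumes "is_square_in R a" "is_square_in R b"
  shows "is_square_in R (a \<otimes> b)"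
  using assms unfolding is_square_in_def by (metis m_closed nat_pow_distrib m_comm)

text \<open>The index \<open>k\<close> below arises as \<open>\<bar>i + j - (M - 1)\<bar>\<close> for two positions \<open>i \<noteq> j\<close> in the tuple.\<close>

lemma geometric_tuple:
  assumes fin: "finite (carrier R)"
    and \<gamma>: "\<gamma> \<in> carrier R" "\<kappa> = \<gamma> \<otimes> \<gamma>" "\<kappa> \<otimes> \<kappa> = \<one>"
    and x: "x \<in> carrier R" "x \<noteq> \<zero>"
    and ord: "\<And>j. j \<in> {1..<M} \<Longrightarrow> x [^] (2 * j) \<noteq> \<one>"
    and sq: "\<And>k. k + 2 \<le> M \<Longrightarrow> is_square_in R (\<one> \<oplus> \<kappa> \<otimes> x [^] (2 * k))"
  shows "max_diophantine R \<ge> M"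
proof -
  have pow_nz: "x [^] n \<noteq> \<zero>" for n :: nat using nat_pow_eq_zero x by blast
  then have unit: "x [^] n \<in> Units R" for n :: nat using x by (simp add: field_Units)
  have \<kappa>: "\<kappa> \<in> carrier R" using \<gamma> by simp
  have "\<gamma> \<noteq> \<zero>" using \<gamma> by auto
  \<comment> \<open>Dividing by x^(M - 1) centres the exponents: \<open>a i\<close> below is
    \<gamma> x^(2 i - (M - 1)).\<close>
  define z where "z = inv (x [^] (M - 1))"
  have z: "z \<in> carrier R" "z \<otimes> x [^] (M - 1) = \<one>" 
    using unit[of "M - 1"] by (auto simp: z_def Units_l_inv)
  then have "z \<noteq> \<zero>" using x by auto
  define a where "a i = \<gamma> \<otimes> z \<otimes> x [^] (2 * i)" for i :: nat
  have a_carr: "a i \<in> carrier R" "a i \<noteq> \<zero>" for i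
    using \<gamma>(1) z(1) x(1) \<open>\<gamma> \<noteq> \<zero>\<close> \<open>z \<noteq> \<zero>\<close> pow_nz by (auto simp: a_def integral_iff)
  have neq: "a i \<noteq> a j" if "i < j" "j < M" for i j
  proof
    assume "a i = a j"
    then have "x [^] (2 * i) = x [^] (2 * j)"
      using \<gamma>(1) z(1) x(1) \<open>\<gamma> \<noteq> \<zero>\<close> \<open>z \<noteq> \<zero>\<close> by (simp add: a_def m_lcancel integral_iff)
    also have "2 * j = 2 * i + 2 * (j - i)" using that by simp
    finally have "x [^] (2 * i) \<otimes> \<one> = x [^] (2 * i) \<otimes> x [^] (2 * (j - i))"
      using x(1) by (metis nat_pow_mult r_one nat_pow_closed)
    then have "x [^] (2 * (j - i)) = \<one>"
      using x(1) pow_nz m_lcancel by (metis nat_pow_closed one_closed)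
    moreover have "j - i \<in> {1..<M}" using that by auto
    ultimately show False using ord by blast
  qed
  then have "inj_on a {..<M}" by (intro linorder_inj_onI) auto
  have square: "is_square_in R (a i \<otimes> a j \<oplus> \<one>)" if ij: "i \<noteq> j" "i < M" "j < M" for i j
  proof -
    have prod: "a i \<otimes> a j = \<kappa> \<otimes> (z \<otimes> z \<otimes> x [^] (2 * (i + j)))"
      using \<gamma> z x by (simp add: a_def m_ac nat_pow_mult[symmetric] distrib_left)
    show ?thesis
    proof (cases "M - 1 \<le> i + j")
      case True
      define k where "k = i + j - (M - 1)"
      have "2 * (i + j) = (M - 1) + (M - 1) + 2 * k" using True by (simp add: k_def)
      then have "x [^] (2 * (i + j)) = x [^] (M - 1) \<otimes> x [^] (M - 1) \<otimes> x [^] (2 * k)"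
        using x(1) by (simp only: nat_pow_mult)
      then have "z \<otimes> z \<otimes> x [^] (2 * (i + j)) =
          (z \<otimes> x [^] (M - 1)) \<otimes> (z \<otimes> x [^] (M - 1)) \<otimes> x [^] (2 * k)"
        using z(1) x by (simp add: m_ac)
      then have "a i \<otimes> a j \<oplus> \<one> = \<one> \<oplus> \<kappa> \<otimes> x [^] (2 * k)"
        using prod z x \<kappa> by (simp add: a_comm)
      \<comment> \<open>Distinct positions below M give i + j <= 2 M - 3, so k is at most M -
        2.\<close>
      moreover have "k + 2 \<le> M" using ij by (auto simp: k_def)
      ultimately show ?thesis using sq by simp
    next
      case False
      define k where "k = M - 1 - (i + j)"
      define w where "w = z \<otimes> x [^] (i + j)"
      have w: "w \<in> carrier R" using z x by (simp add: w_def)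
      have dbl: "x [^] (2 * n) = x [^] n \<otimes> x [^] n" for n :: nat
        using x(1) by (simp add: mult_2 nat_pow_mult)
      have ww: "z \<otimes> z \<otimes> x [^] (2 * (i + j)) = w \<otimes> w"
        unfolding dbl using z(1) x by (simp add: w_def m_ac)
      have "w \<otimes> x [^] k = z \<otimes> x [^] (M - 1)"
        using z(1) x False by (simp add: w_def m_assoc nat_pow_mult k_def)
      then have "w \<otimes> x [^] k = \<one>" using z by simp
      moreover have "w \<otimes> w \<otimes> x [^] (2 * k) = (w \<otimes> x [^] k) \<otimes> (w \<otimes> x [^] k)"
        unfolding dbl using w x by (simp add: m_ac)
      ultimately have wx: "w \<otimes> w \<otimes> x [^] (2 * k) = \<one>" by simp
      \<comment> \<open>For a negative total exponent, \<kappa> w^2 + 1 = \<kappa> w^2 (1 + \<kappa>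
        x^(2 k)), because \<kappa>^2 = 1 and w^2 x^(2 k) = 1; the factor \<kappa> w^2 is the square
        of \<gamma> w.\<close>
      have "\<kappa> \<otimes> (w \<otimes> w) \<otimes> (\<kappa> \<otimes> x [^] (2 * k)) = (\<kappa> \<otimes> \<kappa>) \<otimes> (w \<otimes> w \<otimes> x [^] (2 * k))"
        using w x \<kappa> by (simp add: m_ac)
      then have "\<kappa> \<otimes> (w \<otimes> w) \<otimes> (\<one> \<oplus> \<kappa> \<otimes> x [^] (2 * k)) = \<kappa> \<otimes> (w \<otimes> w) \<oplus> \<one>"
        using w x \<kappa> wx \<gamma>(3) by (simp add: r_distr)
      then have eq: "a i \<otimes> a j \<oplus> \<one> = \<kappa> \<otimes> (w \<otimes> w) \<otimes> (\<one> \<oplus> \<kappa> \<otimes> x [^] (2 * k))"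
        using prod ww by simp
      have "\<kappa> \<otimes> (w \<otimes> w) = (\<gamma> \<otimes> w) [^] (2::nat)"
        using \<gamma> w by (simp add: m_ac numeral_2_eq_2)
      then have "is_square_in R (\<kappa> \<otimes> (w \<otimes> w))"
        unfolding is_square_in_def using \<gamma>(1) w by blast
      moreover have "k + 2 \<le> M" using ij False by (auto simp: k_def)
      ultimately show ?thesis unfolding eq using sq square_mult by blast
    qed
  qed
  have "diophantine_tuple R (a ` {..<M})"
    unfolding diophantine_tuple_def using a_carr by (auto intro!: square)
  then show ?thesis
    using max_diophantine_ge[OF fin] \<open>inj_on a {..<M}\<close> by (fastforce simp: card_image)
qed

text \<open>If q is 1 modulo 4, then -1 has a square root and 1 + \<kappa> = 0. If q is 7 modulo 8,
  then so is p, and 2 is a square already in the prime field. The integer \<open>c\<close>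
  represents \<kappa> in Z[X].\<close>

lemma sign_choice:
  assumes fin: "finite (carrier R)" and ord: "order R = q" and q: "q = p ^ k" "q mod 8 \<in> {1, 5, 7}"
    and p: "prime p" "odd p"
  obtains \<gamma> \<kappa> and c :: int where "\<gamma> \<in> carrier R" "\<kappa> = \<gamma> \<otimes> \<gamma>" "\<kappa> \<otimes> \<kappa> = \<one>"
    "is_square_in R (\<one> \<oplus> \<kappa>)" "\<kappa> = [c] \<cdot> \<one>" "c * c = 1"
proof (cases "q mod 4 = 1")
  case True
  define h where "h = q div 2"
  have h: "q = 2 * h + 1" "even h" using True unfolding h_def by presburger+
  then obtain m where "h = 2 * m" by blast
  moreover have "(\<ominus> \<one>) [^] (2::nat) = \<one>"
    by (simp add: numeral_2_eq_2 l_minus)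
  ultimately have "(\<ominus> \<one>) [^] h = \<one>"
    using nat_pow_pow[of "\<ominus> \<one>" 2 m] by simp
  then obtain \<gamma> where \<gamma>: "\<gamma> \<in> carrier R" "\<ominus> \<one> = \<gamma> [^] (2::nat)"
    using euler_square[OF fin, of h "\<ominus> \<one>"] ord h by auto
  show ?thesis
  proof (rule that[of \<gamma> "\<ominus> \<one>" "- 1"])
    show "is_square_in R (\<one> \<oplus> \<ominus> \<one>)"
      unfolding is_square_in_def by (intro bexI[of _ \<zero>]) (simp_all add: r_neg numeral_2_eq_2)
    show "\<ominus> \<one> = [(- 1 :: int)] \<cdot> \<one>"
      using add_pow_int_lt[of "- 1" R \<one>] by (simp add: add_pow_def)
    show "\<ominus> \<one> = \<gamma> \<otimes> \<gamma>" using \<gamma> by (simp add: numeral_2_eq_2)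
    show "\<ominus> \<one> \<otimes> \<ominus> \<one> = \<one>" by (simp add: l_minus)
  qed (use \<gamma> in simp_all)
next
  case False
  moreover have "q mod 8 = 1 \<or> q mod 8 = 5 \<or> q mod 8 = 7" using q(2) by simp
  ultimately have "q mod 8 = 7" by presburger
  have "p mod 8 = 7"
  proof -
    have "p mod 8 = 1 \<or> p mod 8 = 3 \<or> p mod 8 = 5 \<or> p mod 8 = 7"
      using p(2) by presburger
    then have "(p mod 8)\<^sup>2 mod 8 = 1" by auto
    then have "p\<^sup>2 mod 8 = 1" by (simp add: power_mod)
    then have *: "(p\<^sup>2) ^ j mod 8 = 1" for j
      using power_mod[of "p\<^sup>2" 8 j] by simp
    show ?thesis
    proof (cases "even k")
      case True
      then obtain j where "k = 2 * j" by blast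
      then show ?thesis using * \<open>q mod 8 = 7\<close> q(1) by (simp add: power_mult)
    next
      case False
      then obtain j where "k = 2 * j + 1" by (auto elim: oddE)
      then have "q = p * (p\<^sup>2) ^ j" using q(1) by (simp add: power_mult)
      then have "q mod 8 = (p * 1) mod 8"
        using *[of j] mod_mult_right_eq[of p "(p\<^sup>2) ^ j" 8] by simp
      then show ?thesis using \<open>q mod 8 = 7\<close> by simp
    qed
  qed
  then obtain y where y: "int p dvd y\<^sup>2 - 2" using two_QuadRes[OF p(1)] by blast
  have eval: "int_poly_eval \<zero> [:a:] = [a] \<cdot> \<one>" for a
    using add.int_pow_closed[OF one_closed, of a] by (simp add: add_pow_def)
  obtain b where "y\<^sup>2 - 2 = int p * b" using y by blast
  then have "y * y = 2 + int p * b" by (simp add: power2_eq_square)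
  then have "[y] \<cdot> \<one> \<otimes> [y] \<cdot> \<one> = [(2::int)] \<cdot> \<one> \<oplus> [int p] \<cdot> \<one> \<otimes> [b] \<cdot> \<one>"
    by (metis add_pow_int_add add_pow_int_mult zero_closed)
  moreover have "[int p] \<cdot> \<one> = \<zero>"
    using char_power[OF fin] ord q(1) by (simp add: add_pow_def int_pow_int)
  moreover have "[(2::int)] \<cdot> \<one> = \<one> \<oplus> \<one>"
    using add_pow_int_add[of \<zero> 1 1] add.int_pow_1[OF one_closed] by (simp add: add_pow_def)
  ultimately have "is_square_in R (\<one> \<oplus> \<one>)"
    unfolding is_square_in_def using add.int_pow_closed[OF one_closed]
    by (intro bexI[of _ "[y] \<cdot> \<one>"]) (simp_all add: add_pow_def numeral_2_eq_2)
  then show ?thesis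
    using add.int_pow_1[OF one_closed] by (intro that[of \<one> \<one> 1]) (simp_all add: add_pow_def)
qed

text \<open>Settles the bounds of size at most 2, so that the numerical estimates can start at
  \<open>M \<ge> 3\<close>.\<close>

lemma max_diophantine_ge_2:
  assumes fin: "finite (carrier R)" and ord: "order R = q" and q: "q = p ^ k" "q mod 8 \<in> {1, 5, 7}" "q > 7"
    and p: "prime p" "odd p"
  shows "max_diophantine R \<ge> 2"
proof -
  obtain \<gamma> \<kappa> and c :: int where *: "\<gamma> \<in> carrier R" "\<kappa> = \<gamma> \<otimes> \<gamma>" "\<kappa> \<otimes> \<kappa> = \<one>"
      "is_square_in R (\<one> \<oplus> \<kappa>)"
    using sign_choice[OF fin ord q(1,2) p] by metis
  define B where "B = insert \<zero> {x \<in> carrier R. x [^] (2::nat) = \<one>}"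
  have "card B \<le> Suc 2"
    unfolding B_def using num_roots_le_deg[OF fin, of 2] by (intro card_insert_le_m1) auto
  then have "\<not> carrier R \<subseteq> B"
    using q(3) ord card_mono[of B "carrier R"] fin by (auto simp: order_def B_def)
  then obtain x where x: "x \<in> carrier R" "x \<noteq> \<zero>" "x [^] (2::nat) \<noteq> \<one>"
    by (auto simp: B_def)
  show ?thesis
  proof (rule geometric_tuple[OF fin *(1-3) x(1,2)])
    show "x [^] (2 * j) \<noteq> \<one>" if "j \<in> {1..<2}" for j :: nat
    proof -
      have "j = 1" using that by simp
      then show ?thesis using x(3) by simp
    qed
    show "is_square_in R (\<one> \<oplus> \<kappa> \<otimes> x [^] (2 * k))" if "k + 2 \<le> 2" for k :: nat
      using that * by simp
  qed
qed

text \<open>By \<open>frobenius_multiples\<close> only the exponents in \<open>K\<close> need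
  character sums. The term \<open>M * M\<close> accounts for the excluded ratios: zero and the roots
  of unity that would make two members of the progression equal.\<close>

lemma max_diophantine_ge_criterion:
  assumes fin: "finite (carrier R)" and ord: "order R = q" and q: "q = p ^ k" "q mod 8 \<in> {1, 5, 7}"
    and p: "prime p" "odd p"
    and K: "K = {k \<in> {1..M - 2}. \<not> p dvd k}" and e: "e = (\<Sum>k\<in>K. 2 * k)"
    and M: "M \<ge> 2"
    and big: "2 * real e \<le> sqrt q" "sqrt q \<ge> 10"
    and large: "2 ^ card K * ((real e + 4) * sqrt q + e + M * M) < q"
  shows "max_diophantine R \<ge> M"
proof -
  obtain \<gamma> \<kappa> and c :: int where *: "\<gamma> \<in> carrier R" "\<kappa> = \<gamma> \<otimes> \<gamma>" "\<kappa> \<otimes> \<kappa> = \<one>"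
      "is_square_in R (\<one> \<oplus> \<kappa>)" "\<kappa> = [c] \<cdot> \<one>" "c * c = 1"
    by (rule sign_choice[OF fin ord q(1,2) p])
  define h where "h = q div 2"
  have h: "q = 2 * h + 1"
    using p(2) q(1) unfolding h_def by (metis even_power even_two_times_div_two odd_two_times_div_two_succ)
  obtain x T where x: "x \<in> carrier R" and bij: "bij_betw (int_poly_eval x) T (carrier R)"
    and frf: "finite_residue_field {P. int_poly_eval x P = \<zero>} T p k q h"
    by (rule finite_field_residue[OF fin ord q(1) h p(1)])
  interpret F: finite_residue_field "{P. int_poly_eval x P = \<zero>}" T p k q h by (rule frf)
  let ?\<phi> = "int_poly_eval x"
  note [simp] = int_poly_eval_closed[OF x]
  define Z where "Z = insert \<zero> (\<Union>j\<in>{1..<M}. {y \<in> carrier R. y [^] (2 * j) = \<one>})"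
  define B where "B = {t \<in> T. ?\<phi> t \<in> Z}"
  have "finite Z" unfolding Z_def using fin by auto
  have "card Z \<le> M * M"
  proof -
    have "card Z \<le> Suc (card (\<Union>j\<in>{1..<M}. {y \<in> carrier R. y [^] (2 * j) = \<one>}))"
      unfolding Z_def using \<open>finite Z\<close> by (intro card_insert_le_m1) (auto simp: Z_def)
    also have "\<dots> \<le> Suc (\<Sum>j\<in>{1..<M}. card {y \<in> carrier R. y [^] (2 * j) = \<one>})"
      using card_UN_le[of "{1..<M}"] by simp
    also have "\<dots> \<le> Suc (\<Sum>j\<in>{1..<M}. 2 * j)"
      using num_roots_le_deg[OF fin] by (intro Suc_le_mono[THEN iffD2] sum_mono) auto
    also have "\<dots> \<le> M * M"
    proof -
      have "(\<Sum>j\<in>{1..<n}. 2 * j) + n = n * n" for n :: nat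
        by (induction n) auto
      from this[of M] M show ?thesis by linarith
    qed
    finally show ?thesis .
  qed
  moreover have "card B \<le> card Z"
    using bij \<open>finite Z\<close> by (intro card_inj_on_le[of ?\<phi>]) (auto simp: B_def bij_betw_def inj_on_def)
  ultimately have cB: "card B \<le> M * M" by simp
  have "2 ^ card K * ((real e + 4) * sqrt q + e + real (card B)) \<le> 2 ^ card K * ((real e + 4) * sqrt q + e + real (M * M))"
    using of_nat_mono[OF cB, where 'a = real] by (intro mult_left_mono) auto
  then have lt: "2 ^ card K * ((real e + 4) * sqrt q + e + card B) < q"
    using large by linarith
  have fK: "finite K" "\<And>k. k \<in> K \<Longrightarrow> k > 0" "B \<subseteq> T" by (auto simp: K B_def)
  obtain u where u: "u \<in> T - B"
    and good: "\<And>k. k \<in> K \<Longrightarrow> (1 + [:c:] * u ^ (2 * k)) ^ h - 1 \<in> {P. ?\<phi> P = \<zero>}"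
    using F.simultaneous_squares[OF fK e big lt, of "[:c:]"] by blast
  have all: "(1 + [:c:] * u ^ (2 * k)) ^ h - 1 \<in> {P. ?\<phi> P = \<zero>}" if "k \<in> {1..M - 2}" for k
  proof (rule F.frobenius_multiples[where c = "[:c:]" and m = "M - 2" and u = u and i = k])
    show "[:c:] * [:c:] = 1" using *(6) by (simp add: one_pCons)
  qed (use good that K in auto)
  define y where "y = ?\<phi> u"
  have y: "y \<in> carrier R" "y \<notin> Z" using u by (auto simp: y_def B_def)
  have \<kappa>: "?\<phi> [:c:] = \<kappa>" "\<kappa> \<in> carrier R"
    using * x add.int_pow_closed[OF one_closed, of c] by (simp_all add: add_pow_def)
  show ?thesis
  proof (rule geometric_tuple[OF fin *(1-3) y(1)])
    show "y \<noteq> \<zero>" using y by (auto simp: Z_def)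
    show "y [^] (2 * j) \<noteq> \<one>" if "j \<in> {1..<M}" for j
      using that y by (auto simp: Z_def)
    show "is_square_in R (\<one> \<oplus> \<kappa> \<otimes> y [^] (2 * k))" if "k + 2 \<le> M" for k
    proof (cases "k = 0")
      case True
      then show ?thesis using * \<kappa> by simp
    next
      case False
      then have "?\<phi> ((1 + [:c:] * u ^ (2 * k)) ^ h - 1) = \<zero>" using all[of k] that by auto
      moreover have "?\<phi> ((1 + [:c:] * u ^ (2 * k)) ^ h - 1) = (\<one> \<oplus> \<kappa> \<otimes> y [^] (2 * k)) [^] h \<ominus> \<one>"
        by (simp only: int_poly_eval_diff[OF x] int_poly_eval_power[OF x] int_poly_eval_add[OF x]
            int_poly_eval_mult[OF x] int_poly_eval_1[OF x] \<kappa>(1) y_def)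
      ultimately have "(\<one> \<oplus> \<kappa> \<otimes> y [^] (2 * k)) [^] h \<ominus> \<one> = \<zero>"
        by (simp only:)
      then have "(\<one> \<oplus> \<kappa> \<otimes> y [^] (2 * k)) [^] h = \<one>"
        using \<kappa> y by simp
      then show ?thesis
        using euler_square[OF fin, of h] ord h \<kappa> y unfolding is_square_in_def by simp
    qed
  qed
qed

end

section \<open>Numerical estimates\<close>

lemma multiples_eq: "p > 0 \<Longrightarrow> {k \<in> {1..n}. p dvd k} = (\<lambda>j. p * j) ` {1..n div p}" for n p :: nat
  by (auto simp: image_iff less_eq_div_iff_mult_less_eq mult.commute Suc_le_eq elim!: dvdE)

text \<open>The multiples of p remove J = n div p from the count and p J (J + 1) from the sum; n + 1
  <= p (J + 1) then gives both bounds.\<close>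

lemma
  fixes p n :: nat
  assumes "p > 0"
  defines "K \<equiv> {k \<in> {1..n}. \<not> p dvd k}"
  shows card_nonmultiples_le: "p * card K \<le> (p - 1) * (n + 1)"
    and sum_nonmultiples_le: "p * (\<Sum>k\<in>K. 2 * k) \<le> (p - 1) * (n + 1) * (n + 1)"
proof -
  define J where "J = n div p"
  have inj: "inj_on (\<lambda>j. p * j) S" for S using assms(1) by (simp add: inj_on_def)
  have split: "K \<union> (\<lambda>j. p * j) ` {1..J} = {1..n}" "K \<inter> (\<lambda>j. p * j) ` {1..J} = {}" "finite K"
    unfolding J_def multiples_eq[OF assms(1), symmetric] by (auto simp: K_def)
  have "card K + card ((\<lambda>j. p * j) ` {1..J}) = n"
    using split by (subst card_Un_disjoint[symmetric]) auto
  then have cK: "card K + J = n" by (simp add: card_image[OF inj])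
  have "(\<Sum>k\<in>K. 2 * k) + (\<Sum>k\<in>(\<lambda>j. p * j) ` {1..J}. 2 * k) = (\<Sum>k\<in>{1..n}. 2 * k)"
    using split by (subst sum.union_disjoint[symmetric]) auto
  moreover have gauss: "(\<Sum>k\<in>{1..m}. 2 * k) = m * (m + 1)" for m :: nat
    by (induction m) auto
  moreover have "(\<Sum>k\<in>(\<lambda>j. p * j) ` {1..J}. 2 * k) = p * (J * (J + 1))"
    unfolding gauss[symmetric] sum_distrib_left by (subst sum.reindex[OF inj]) (simp add: mult.left_commute)
  ultimately have eK: "(\<Sum>k\<in>K. 2 * k) + p * (J * (J + 1)) = n * (n + 1)" by simp
  have "n = p * J + n mod p" by (simp add: J_def)
  moreover have "n mod p < p" using assms(1) by simp
  ultimately have J: "n + 1 \<le> p * (J + 1)" by simp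
  obtain r where r: "p = r + 1" using assms(1) by (cases p) auto
  have "p * card K + p * J = p * n" using cK by (simp flip: distrib_left)
  then show "p * card K \<le> (p - 1) * (n + 1)" using J by (simp add: r algebra_simps)
  have "(n + 1) * (n + 1) \<le> (p * (J + 1)) * (n + 1)" using J by (intro mult_le_mono1)
  moreover have "(n + 1) * (p * J) + p * (n + 1) \<le> p * J * (p * (J + 1)) + p * (n + 1)"
    using mult_le_mono2[OF J, of "p * J"] by (simp add: algebra_simps)
  moreover have "p * (\<Sum>k\<in>K. 2 * k) + p * (p * (J * (J + 1))) = p * (n * (n + 1))"
    unfolding distrib_left[symmetric] eK ..
  ultimately show "p * (\<Sum>k\<in>K. 2 * k) \<le> (p - 1) * (n + 1) * (n + 1)"
    by (simp add: r algebra_simps)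
qed

lemma ln_2_ge: "ln 2 \<ge> (0.69 :: real)"
proof -
  have "ln 2 \<ge> (\<Sum>k<2. 2 * ((2 - 1) / (2 + 1)) ^ (2 * k + 1) / of_nat (2 * k + 1) :: real)"
    using ln_approx_bounds[of 2 2] by simp
  then show ?thesis by (simp add: eval_nat_numeral)
qed

lemma ln_ge_of_power_le:
  fixes x :: real
  assumes "x > 0" "2 ^ m \<le> x ^ n" "n > 0"
  shows "ln x \<ge> m * 0.69 / n"
proof -
  have "m * ln 2 \<le> n * ln x"
    using assms by (simp flip: ln_realpow)
  moreover have "m * 0.69 \<le> m * ln 2" using ln_2_ge by (intro mult_left_mono) auto
  ultimately have "m * 0.69 \<le> n * ln x" by linarith
  then show ?thesis using assms(3) by (simp add: divide_le_eq mult.commute mult.left_commute)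
qed

text \<open>
  With \<open>L = ln q\<close> the hypothesis gives \<open>2\<^sup>|\<^sup>K\<^sup>| \<le> 2 powr (1 / 3) * \<surd>q / L\<^sup>2\<close>, and \<open>e\<close> is smaller than
  \<open>L\<^sup>2 / 2 powr (1 / 3)\<close>, most narrowly for \<open>p = 3\<close>.
\<close>

lemma numeric_estimates:
  fixes p q M :: nat
  assumes p: "p \<ge> 3" and q: "q > 7" and M: "M \<ge> 3"
    and le: "real M \<le> real p / (real p - 1) * ((1 / 2 * ln (real q) - 2 * ln (ln (real q))) / ln 2 + 1)"
    and K: "K = {k \<in> {1..M - 2}. \<not> p dvd k}" and e: "e = (\<Sum>k\<in>K. 2 * k)"
  shows "2 * real e \<le> sqrt q" "sqrt q \<ge> 10"
    "2 ^ card K * ((real e + 4) * sqrt q + e + M * M) < q"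
proof -
  define L where "L = ln (real q)"
  define W where "W = (L / 2 - 2 * ln L) / ln 2"
  define x where "x = (real p - 1) / real p"
  have x: "2 / 3 \<le> x" "x < 1" using p by (auto simp: x_def field_simps)
  have "real M \<le> (W + 1) / x"
    using le p by (simp add: W_def L_def x_def mult.commute)
  then have Mx: "real M * x \<le> W + 1" using x by (simp add: pos_le_divide_eq)
  have "3 * (2 / 3) \<le> real M * x" using x M by (intro mult_mono) auto
  then have "W \<ge> 1" using Mx by simp
  then have "W * ln 2 \<ge> 1 * ln 2" by (intro mult_right_mono) auto
  moreover have Wln: "W * ln 2 = L / 2 - 2 * ln L" by (simp add: W_def)
  \<comment> \<open>This inequality improves every lower bound on \<open>L\<close>; starting from 2,
    a few rounds reach 10.\<close>
  ultimately have L_ge: "L \<ge> 1.38 + 4 * ln L" using ln_2_ge by linarith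
  have "L \<ge> 2"
    using ln_ge_of_power_le[of "real q" 3 1] q by (simp add: L_def)
  then have "L \<ge> 4"
    using ln_ge_of_power_le[of L 1 1] L_ge by simp
  then have "L \<ge> 6.9"
    using ln_ge_of_power_le[of L 2 1] L_ge by simp
  then have "2 ^ 11 \<le> L ^ 4"
    using power_mono[of "6.9" L 4] by (simp add: power_divide)
  then have "L \<ge> 8.9"
    using ln_ge_of_power_le[of L 11 4] L_ge \<open>L \<ge> 4\<close> by simp
  then have "L \<ge> 9.6"
    using ln_ge_of_power_le[of L 3 1] L_ge by simp
  then have "2 ^ 13 \<le> L ^ 4"
    using power_mono[of "9.6" L 4] by (simp add: power_divide)
  then have L10: "L \<ge> 10"
    using ln_ge_of_power_le[of L 13 4] L_ge \<open>L \<ge> 4\<close> by simp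
  \<comment> \<open>The shift 7.8 is 2 * 3 * 1.3, so that exp (L / 2) splits off the cube of exp
    1.3, which is at least 27. It also fits the linear bound \<open>vt\<close>.\<close>
  define t where "t = L - 7.8"
  have t: "t \<ge> 2" using L10 by (simp add: t_def)
  \<comment> \<open>\<open>v\<close> will bound \<open>card K\<close>, and
    \<open>(real M - 1) * v\<close> will bound \<open>e\<close>.\<close>
  define v where "v = (real M - 1) * x"
  have v0: "v \<ge> 0" using M x by (simp add: v_def)
  have vW: "v \<le> W + 1 / 3" using Mx x by (simp add: v_def algebra_simps)
  have "ln L \<ge> 2.07" using ln_ge_of_power_le[of L 3 1] L10 by simp
  moreover have "W * 0.69 \<le> W * ln 2" using ln_2_ge \<open>W \<ge> 1\<close> by (intro mult_left_mono) auto
  \<comment> \<open>The slope 0.725 slightly exceeds 1 / (2 * 0.69), which comes from the bound on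
    ln 2.\<close>
  ultimately have vt: "v \<le> 0.725 * t" using vW Wln L10 by (simp add: t_def)
  have "v * v \<le> (0.725 * t) * (0.725 * t)" using vt v0 by (intro mult_mono) auto
  then have vv: "v * v \<le> 0.525625 * (t * t)" by simp
  \<comment> \<open>The factor 1.5 is 1 / x for p = 3, the largest value that occurs.\<close>
  have M1: "real M - 1 \<le> 1.5 * v"
    using mult_left_mono[OF x(1), of "real M - 1"] M by (simp add: v_def)
  have n: "M - 2 + 1 = M - 1" using M by simp
  have "p * card K \<le> (p - 1) * (M - 1)"
    unfolding K using card_nonmultiples_le[of p "M - 2"] p unfolding n by simp
  from of_nat_mono[OF this, where 'a = real] have "real p * card K \<le> real p * v"
    using p M by (simp add: of_nat_diff v_def x_def mult.commute)
  then have cK: "card K \<le> v" using p by simp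
  have "p * e \<le> (p - 1) * (M - 1) * (M - 1)"
    unfolding K e using sum_nonmultiples_le[of p "M - 2"] p unfolding n by simp
  from of_nat_mono[OF this, where 'a = real] have "real p * e \<le> real p * ((real M - 1) * v)"
    using p M by (simp add: of_nat_diff v_def x_def mult_ac)
  then have "e \<le> (real M - 1) * v" using p by simp
  also have "\<dots> \<le> 1.5 * v * v" using M1 v0 by (intro mult_right_mono) auto
  finally have eK: "real e \<le> 0.7885 * (t * t)" using vv by simp
  have s: "sqrt q = exp (L / 2)"
    using q by (simp add: L_def flip: ln_sqrt)
  have "L / 2 = real 3 * 1.3 + t / 2" by (simp add: t_def field_simps)
  then have "exp (L / 2) = exp 1.3 ^ 3 * exp (t / 2)" by (simp only: exp_add exp_of_nat_mult)
  moreover have "exp (1.3 :: real) \<ge> 1 + 1.3 + 1.3\<^sup>2 / 2"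
    using exp_lower_Taylor_quadratic[of "1.3"] by simp
  then have "exp (1.3 :: real) ^ 3 \<ge> 3 ^ 3"
    by (intro power_mono) (auto simp: power2_eq_square)
  moreover have "exp (t / 2) \<ge> 1 + t / 2 + t * t / 8"
    using exp_lower_Taylor_quadratic[of "t / 2"] t by (simp add: power2_eq_square)
  ultimately have "sqrt q \<ge> 3 ^ 3 * (1 + t / 2 + t * t / 8)"
    unfolding s using t by (simp only:) (intro mult_mono, auto)
  then have big: "sqrt q \<ge> 27 + 13.5 * t + 3.375 * (t * t)" by simp
  then show "sqrt q \<ge> 10" "2 * real e \<le> sqrt q" using t eK by auto
  have "real M * real M \<le> (1.5 * v + 1) * (1.5 * v + 1)"
    using M1 M v0 by (intro mult_mono) auto
  also have "\<dots> = 2.25 * (v * v) + 3 * v + 1" by (simp add: algebra_simps)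
  finally have "e + real (M * M) \<le> sqrt q"
    using eK vv vt big t by auto
  have "2 ^ card K = 2 powr (card K)" by (simp add: powr_realpow)
  also have "\<dots> \<le> 2 powr (W + 1 / 3)" using cK vW by (intro powr_mono) auto
  also have "\<dots> = sqrt q / L\<^sup>2 * 2 powr (1 / 3)"
  proof -
    have "2 powr W = exp (L / 2 - 2 * ln L)"
      using Wln by (simp add: powr_def)
    moreover have "exp (2 * ln L) = L\<^sup>2"
      using exp_of_nat_mult[of 2 "ln L"] L10 by simp
    then have "exp (L / 2 - 2 * ln L) = sqrt q / L\<^sup>2"
      unfolding s exp_diff by simp
    ultimately show ?thesis by (simp add: powr_add)
  qed
  also have "\<dots> \<le> sqrt q / L\<^sup>2 * 1.26"
  proof (intro mult_left_mono)
    have "(2 powr (1 / 3)) ^ Suc 2 \<le> (1.26 :: real) ^ Suc 2"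
      by (simp add: powr_power power_divide)
    then show "2 powr (1 / 3) \<le> (1.26 :: real)"
      by (rule power_le_imp_le_base) simp
  qed auto
  finally have two: "2 ^ card K \<le> sqrt q / L\<^sup>2 * 1.26" .
  have "(real e + 4) * sqrt q + e + M * M \<le> (real e + 5) * sqrt q"
    using \<open>e + real (M * M) \<le> sqrt q\<close> by (simp add: algebra_simps)
  then have "2 ^ card K * ((real e + 4) * sqrt q + e + M * M) \<le>
      (sqrt q / L\<^sup>2 * 1.26) * ((real e + 5) * sqrt q)"
    using two by (intro mult_mono) auto
  also have "\<dots> = (1.26 * (real e + 5)) * (sqrt q * sqrt q) / L\<^sup>2"
    by (simp add: mult_ac)
  also have "\<dots> = (1.26 * (real e + 5)) * q / L\<^sup>2"
    by simp
  also have "\<dots> < q"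
  proof -
    \<comment> \<open>The product 1.26 * 0.7885 is just below 1, the coefficient of t^2 on the
      right.\<close>
    have "1.26 * (real e + 5) < L\<^sup>2"
      using eK t by (simp add: t_def power2_eq_square algebra_simps)
    then show ?thesis
      using q L10 by (simp add: divide_less_eq)
  qed
  finally show "2 ^ card K * ((real e + 4) * sqrt q + e + M * M) < q" .
qed

section \<open>The explicit bound and its asymptotic form\<close>

definition tuple_bound :: "nat \<Rightarrow> nat \<Rightarrow> real" where
  "tuple_bound p q = real p / (real p - 1) *
     ((1 / 2 * ln (real q) - 2 * ln (ln (real q))) / ln 2 + 1)"

lemma max_diophantine_ge_floor:
  assumes p: "prime p" "odd p" and q: "q = p ^ k" "q > 7" "q mod 8 \<in> {1, 5, 7}" and F: "is_GF q F"
  shows "\<lfloor>tuple_bound p q\<rfloor> \<le> int (max_diophantine F)"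
proof -
  interpret field F using F by (simp add: is_GF_def)
  have fin: "finite (carrier F)" and ord: "order F = q" using F by (auto simp: is_GF_def)
  \<comment> \<open>A negative floor becomes \<open>M = 0\<close>, which the case below 3
    covers.\<close>
  define M where "M = nat \<lfloor>tuple_bound p q\<rfloor>"
  have M_le: "\<lfloor>tuple_bound p q\<rfloor> \<le> int M" by (simp add: M_def)
  have "M \<le> max_diophantine F"
  proof (cases "M \<ge> 3")
    case False
    then show ?thesis using max_diophantine_ge_2[OF fin ord q(1,3,2) p] by simp
  next
    case True
    then have "real M \<le> tuple_bound p q" unfolding M_def by linarith
    moreover have "p \<ge> 3" using p prime_ge_2_nat[of p] by (cases "p = 2") auto
    ultimately show ?thesis
      using True max_diophantine_ge_criterion[OF fin ord q(1,3) p refl refl, of M]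
        numeric_estimates[OF _ q(2) True _ refl refl, of p]
      by (simp add: tuple_bound_def)
  qed
  then show ?thesis using M_le by linarith
qed

text \<open>Without the floor the quotient tends to p / (p - 1), and rounding changes it by at most
  1 / log 4 q, which tends to 0.\<close>

lemma floor_tuple_bound_asymp:
  assumes "p > 1"
  shows "((\<lambda>q. real p / (real p - 1) - \<lfloor>tuple_bound p q\<rfloor> / log 4 (real q)) \<longlongrightarrow> 0) sequentially"
proof -
  define c where "c = real p / (real p - 1)"
  define g where "g x = ((1 / 2 * ln x - 2 * ln (ln x)) / ln 2 + 1) / (ln x / (2 * ln 2))" for x :: real
  have "ln (4 :: real) = ln (2 ^ 2)" by simp
  then have "ln (4 :: real) = 2 * ln 2" by (simp only: ln_realpow)
  then have log4: "log 4 x = ln x / (2 * ln 2)" for x by (simp add: log_def)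
  have "(g \<longlongrightarrow> 1) at_top" unfolding g_def by real_asymp
  then have g: "((\<lambda>n. g (real n)) \<longlongrightarrow> 1) sequentially"
    by (rule filterlim_compose[OF _ filterlim_real_sequentially])
  have inv: "((\<lambda>n::nat. 1 / log 4 (real n)) \<longlongrightarrow> 0) sequentially" 
    unfolding log4 by real_asymp
  have bounds: "c - c * g (real n) \<le> c - \<lfloor>tuple_bound p n\<rfloor> / log 4 (real n)"
      "c - \<lfloor>tuple_bound p n\<rfloor> / log 4 (real n) \<le> c - c * g (real n) + 1 / log 4 (real n)"
    if "n > 1" for n
  proof -
    have pos: "log 4 (real n) > 0" using that by simp
    have "c * g (real n) = tuple_bound p n / log 4 (real n)"
      by (simp add: c_def g_def tuple_bound_def log4)
    moreover have "\<lfloor>tuple_bound p n\<rfloor> / log 4 (real n) \<le> tuple_bound p n / log 4 (real n)"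
      using pos by (intro divide_right_mono) auto
    moreover have "(tuple_bound p n - 1) / log 4 (real n) \<le> \<lfloor>tuple_bound p n\<rfloor> / log 4 (real n)"
      using pos by (intro divide_right_mono) linarith+
    ultimately show "c - c * g (real n) \<le> c - \<lfloor>tuple_bound p n\<rfloor> / log 4 (real n)"
      "c - \<lfloor>tuple_bound p n\<rfloor> / log 4 (real n) \<le> c - c * g (real n) + 1 / log 4 (real n)"
      by (auto simp: diff_divide_distrib)
  qed
  have ev: "eventually (\<lambda>n::nat. n > 1) sequentially" by (rule eventually_gt_at_top)
  have "((\<lambda>q. c - \<lfloor>tuple_bound p q\<rfloor> / log 4 (real q)) \<longlongrightarrow> 0) sequentially"
  proof (rule tendsto_sandwich[OF eventually_mono[OF ev bounds(1)] eventually_mono[OF ev bounds(2)]])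
    show "((\<lambda>n. c - c * g (real n)) \<longlongrightarrow> 0) sequentially"
      using tendsto_diff[OF tendsto_const[of c] tendsto_mult[OF tendsto_const[of c] g]] by simp
    then show "((\<lambda>n. c - c * g (real n) + 1 / log 4 (real n)) \<longlongrightarrow> 0) sequentially"
      using tendsto_add[OF _ inv] by fastforce
  qed
  then show ?thesis by (simp add: c_def)
qed

theorem theorem1p1:
  fixes p :: nat
  assumes "prime p" and "odd p"
  shows
    "(\<forall>(q::nat) (F :: ('a, 'b) ring_scheme).
        (\<exists>k. q = p ^ k) \<and> q > 7 \<and> q mod 8 \<in> {1, 5, 7} \<and> is_GF q F \<longrightarrow>
        int (max_diophantine F) \<ge>
          \<lfloor>real p / (real p - 1) *
            ((1 / 2 * ln (real q) - 2 * ln (ln (real q))) / ln 2 + 1)\<rfloor>)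
     \<and>
     (\<exists>err :: nat \<Rightarrow> real. err \<in> o(\<lambda>_. 1) \<and>
        (\<forall>(q::nat) (F :: ('a, 'b) ring_scheme).
           (\<exists>k. q = p ^ k) \<and> q mod 8 \<in> {1, 5, 7} \<and> is_GF q F \<longrightarrow>
           real (max_diophantine F) \<ge>
             (real p / (real p - 1) - err q) * log 4 (real q)))"
proof (intro conjI)
  show "\<forall>(q::nat) (F :: ('a, 'b) ring_scheme).
        (\<exists>k. q = p ^ k) \<and> q > 7 \<and> q mod 8 \<in> {1, 5, 7} \<and> is_GF q F \<longrightarrow>
        int (max_diophantine F) \<ge>
          \<lfloor>real p / (real p - 1) *
            ((1 / 2 * ln (real q) - 2 * ln (ln (real q))) / ln 2 + 1)\<rfloor>"
    using max_diophantine_ge_floor[OF assms] unfolding tuple_bound_def by blast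
  define c where "c = real p / (real p - 1)"
  \<comment> \<open>For q > 7 the error is exactly what the floor bound leaves; for the finitely
    many other q the value \<open>c\<close> makes the lower bound 0.\<close>
  define err where "err q = (if q > 7 then c - \<lfloor>tuple_bound p q\<rfloor> / log 4 (real q) else c)" for q :: nat
  have "p > 1" using assms(1) by (rule prime_gt_1_nat)
  then have "((\<lambda>q. c - \<lfloor>tuple_bound p q\<rfloor> / log 4 (real q)) \<longlongrightarrow> 0) sequentially"
    unfolding c_def by (rule floor_tuple_bound_asymp)
  then have "(err \<longlongrightarrow> 0) sequentially"
    by (rule Lim_transform_eventually)
      (use eventually_gt_at_top[of "7::nat"] in \<open>rule eventually_mono, simp add: err_def\<close>)
  then have "err \<in> o(\<lambda>_. 1)" by (intro smalloI_tendsto) auto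
  moreover have "real (max_diophantine F) \<ge> (c - err q) * log 4 (real q)"
    if "q = p ^ k" "q mod 8 \<in> {1, 5, 7}" "is_GF q F" for q k and F :: "('a, 'b) ring_scheme"
  proof (cases "q > 7")
    case True
    then have "log 4 (real q) > 0" by simp
    then have "log 4 (real q) \<noteq> 0" by linarith
    then have "(c - err q) * log 4 (real q) = \<lfloor>tuple_bound p q\<rfloor>" using True by (simp add: err_def)
    also have "\<dots> \<le> real (max_diophantine F)"
      using max_diophantine_ge_floor[OF assms that(1) True that(2,3)] by linarith
    finally show ?thesis .
  qed (simp add: err_def)
  ultimately show "\<exists>err :: nat \<Rightarrow> real. err \<in> o(\<lambda>_. 1) \<and>
        (\<forall>(q::nat) (F :: ('a, 'b) ring_scheme).
           (\<exists>k. q = p ^ k) \<and> q mod 8 \<in> {1, 5, 7} \<and> is_GF q F \<longrightarrow>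
           real (max_diophantine F) \<ge>
             (real p / (real p - 1) - err q) * log 4 (real q))"
    unfolding c_def by blast
qed

end
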